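(* Let $n\geq 2$. There exists a $PGL(n+1,\mathbb{R})$-equivariant, one-to-one correspondence between the set $\mathcal{E}(\mathbb{S}^n)$ of Riemannian metrics on the sphere $\mathbb{S}^n$ with respect to which all equators are minimal and the set $Curv_+(\mathbb{R}^{n+1})$ of algebraic curvature tensors in $\mathbb{R}^{n+1}$ with positive sectional curvature.
   Context: $\mathbb{S}^n\subset\mathbb{R}^{n+1}$ is the unit sphere centred at the origin. An equator of $\mathbb{S}^n$ is the intersection of $\mathbb{S}^n$ with a hyperplane of $\mathbb{R}^{n+1}$ through the origin. An equator is minimal with respect to a Riemannian metric $g$ if its mean curvature in $(\mathbb{S}^n,g)$ vanishes identically (for $n=2$: it is a geodesic up to parametrization). An algebraic curvature tensor in $\mathbb{R}^{n+1}$ is a $4$-linear map $R:(\mathbb{R}^{n+1})^4\to\mathbb{R}$ such that $R(x,y,z,w)=-R(y,x,z,w)=-R(x,y,w,z)$, $R(x,y,z,w)=R(z,w,x,y)$ and $R(x,y,z,w)+R(x,z,w,y)+R(x,w,y,z)=0$. It has positive sectional curvature if $R(v,w,v,w)>0$ for every orthonormal pair $v,w\in\mathbb{R}^{n+1}$. For $T\in GL(n+1,\mathbb{R})$, let $\phi(T):\mathbb{S}^n\to\mathbb{S}^n$ be the diffeomorphism $\phi(T)(x)=T(x)/|T(x)|$. The group $PGL(n+1,\mathbb{R})=GL(n+1,\mathbb{R})/\{\lambda Id : \lambda\neq 0\}$ acts on the right on $\mathcal{E}(\mathbb{S}^n)$ by $g\cdot[T]=\phi(T)^*g$ and on $Curv_+(\mathbb{R}^{n+1})$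 by $$(R\cdot[T])(x,y,z,w)=\frac{1}{|\det(T)|^{\frac{4}{n+1}}}R(Tx,Ty,Tz,Tw).$$ Both actions are well defined (the antipodal map is an isometry of every metric in $\mathcal{E}(\mathbb{S}^n)$). *)

theory Defs
  imports "HOL-Analysis.Analysis" "HOL-Algebra.Coset"
begin

section \<open>Smooth maps on the unit sphere\<close>

abbreviation unit_sphere :: "'v::euclidean_space set"
  where "unit_sphere \<equiv> sphere 0 1"

primrec Ck_on :: "nat \<Rightarrow> ('v::euclidean_space \<Rightarrow> 'b::real_normed_vector) \<Rightarrow> 'v set \<Rightarrow> bool" where
  "Ck_on 0 f U \<longleftrightarrow> continuous_on U f"
| "Ck_on (Suc k) f U \<longleftrightarrow>
     (\<forall>x\<in>U. f differentiable (at x)) \<and> (\<forall>v. Ck_on k (\<lambda>x. frechet_derivative f (at x) v) U)"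

text \<open>A map on an arbitrary subset is smooth if it is locally the restriction of a smooth map
  defined on an open set of the ambient space.\<close>

definition smooth_on :: "('v::euclidean_space \<Rightarrow> 'b::real_normed_vector) \<Rightarrow> 'v set \<Rightarrow> bool" where
  "smooth_on f S \<longleftrightarrow> (\<forall>x\<in>S. \<exists>U h. open U \<and> x \<in> U \<and> (\<forall>k. Ck_on k h U) \<and> (\<forall>y\<in>U \<inter> S. h y = f y))"

definition sphere_tangent :: "'v::euclidean_space \<Rightarrow> 'v set" where
  "sphere_tangent x = {v. v \<bullet> x = 0}"

text \<open>The differential at \<open>x\<close> of a map \<open>f\<close> on the sphere, evaluated at a tangent vector \<open>v\<close>.
  Precomposing with the radial retraction makes it depend only on the values of \<open>f\<close> on the sphere;
  the retraction has differential the identity on the tangent space at \<open>x\<close>.\<close>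

definition sphere_deriv ::
    "('v::euclidean_space \<Rightarrow> 'b::real_normed_vector) \<Rightarrow> 'v \<Rightarrow> 'v \<Rightarrow> 'b" where
  "sphere_deriv f x v = frechet_derivative (\<lambda>y. f (y /\<^sub>R norm y)) (at x) v"

definition smooth_vector_field :: "('v::euclidean_space \<Rightarrow> 'v) \<Rightarrow> bool" where
  "smooth_vector_field X \<longleftrightarrow>
     (\<forall>x\<in>unit_sphere. X x \<in> sphere_tangent x) \<and> smooth_on X unit_sphere"

definition lie_bracket ::
    "('v::euclidean_space \<Rightarrow> 'v) \<Rightarrow> ('v \<Rightarrow> 'v) \<Rightarrow> 'v \<Rightarrow> 'v" where
  "lie_bracket X Y x = sphere_deriv Y x (X x) - sphere_deriv X x (Y x)"


section \<open>Riemannian metrics on the sphere\<close>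

type_synonym 'v metric = "'v \<Rightarrow> 'v \<Rightarrow> 'v \<Rightarrow> real"

text \<open>\<open>g x u v\<close> is the inner product of the tangent vectors \<open>u\<close>, \<open>v\<close> at the point \<open>x\<close>. The
  value is required to be zero when the arguments are not a point of the sphere and two tangent
  vectors there, so that equality of functions is equality of metrics.\<close>

definition riemannian_metrics :: "'v::euclidean_space metric set" where
  "riemannian_metrics = {g.
     (\<forall>x\<in>unit_sphere. \<forall>u\<in>sphere_tangent x. \<forall>v\<in>sphere_tangent x. \<forall>w\<in>sphere_tangent x. \<forall>c.
        g x (u + v) w = g x u w + g x v w \<and>
        g x (c *\<^sub>R u) w = c * g x u w \<and>
        g x u v = g x v u) \<and>
     (\<forall>x\<in>unit_sphere. \<forall>u\<in>sphere_tangent x. u \<noteq> 0 \<longrightarrow> g x u u > 0) \<and>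
     (\<forall>X Y. smooth_vector_field X \<longrightarrow> smooth_vector_field Y \<longrightarrow>
        smooth_on (\<lambda>x. g x (X x) (Y x)) unit_sphere) \<and>
     (\<forall>x u v. \<not> (x \<in> unit_sphere \<and> u \<in> sphere_tangent x \<and> v \<in> sphere_tangent x) \<longrightarrow>
        g x u v = 0)}"

text \<open>The Levi-Civita connection, given by the Koszul formula: \<open>levi_civita g X Y x\<close> is the value
  at \<open>x\<close> of the covariant derivative of \<open>Y\<close> in the direction of \<open>X\<close>.\<close>

definition levi_civita ::
    "'v::euclidean_space metric \<Rightarrow> ('v \<Rightarrow> 'v) \<Rightarrow> ('v \<Rightarrow> 'v) \<Rightarrow> 'v \<Rightarrow> 'v" where
  "levi_civita g X Y x = (THE w. w \<in> sphere_tangent x \<and>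
     (\<forall>Z. smooth_vector_field Z \<longrightarrow>
        2 * g x w (Z x) =
            sphere_deriv (\<lambda>y. g y (Y y) (Z y)) x (X x)
          + sphere_deriv (\<lambda>y. g y (Z y) (X y)) x (Y x)
          - sphere_deriv (\<lambda>y. g y (X y) (Y y)) x (Z x)
          + g x (lie_bracket X Y x) (Z x)
          - g x (lie_bracket X Z x) (Y x)
          - g x (lie_bracket Y Z x) (X x)))"


section \<open>Mean curvature of equators\<close>

definition equator :: "'v::euclidean_space \<Rightarrow> 'v set" where
  "equator a = unit_sphere \<inter> {x. a \<bullet> x = 0}"

definition equator_tangent :: "'v::euclidean_space \<Rightarrow> 'v \<Rightarrow> 'v set" where
  "equator_tangent a p = {v. v \<bullet> p = 0 \<and> a \<bullet> v = 0}"

definition unit_normal :: "'v::euclidean_space metric \<Rightarrow> 'v \<Rightarrow> 'v \<Rightarrow> 'v \<Rightarrow> bool" where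
  "unit_normal g a p N \<longleftrightarrow>
     N \<in> sphere_tangent p \<and> g p N N = 1 \<and> (\<forall>v\<in>equator_tangent a p. g p N v = 0)"

definition orthonormal_basis ::
    "'v::euclidean_space metric \<Rightarrow> 'v \<Rightarrow> 'v \<Rightarrow> 'v set \<Rightarrow> bool" where
  "orthonormal_basis g a p B \<longleftrightarrow>
     B \<subseteq> equator_tangent a p \<and> span B = equator_tangent a p \<and>
     (\<forall>u\<in>B. \<forall>v\<in>B. g p u v = (if u = v then 1 else 0))"

text \<open>Orthogonal projection of the constant field \<open>v\<close> to the tangent spaces of the sphere. It
  extends a vector tangent to the sphere at some point, and if \<open>a \<bullet> v = 0\<close> then it is tangent to
  the equator \<open>equator a\<close> at all points of that equator.\<close>

definition tangent_extension :: "'v::euclidean_space \<Rightarrow> 'v \<Rightarrow> 'v" where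
  "tangent_extension v x = v - (v \<bullet> x) *\<^sub>R x"

text \<open>The second fundamental form at \<open>p\<close> with respect to the normal \<open>N\<close>, for \<open>v\<close>, \<open>w\<close> tangent
  to an equator through \<open>p\<close>. As usual it does not depend on the chosen extensions of \<open>v\<close> and \<open>w\<close>
  to fields tangent to the equator.\<close>

definition second_fundamental_form ::
    "'v::euclidean_space metric \<Rightarrow> 'v \<Rightarrow> 'v \<Rightarrow> 'v \<Rightarrow> 'v \<Rightarrow> real" where
  "second_fundamental_form g p N v w =
     g p (levi_civita g (tangent_extension v) (tangent_extension w) p) N"

definition mean_curvature ::
    "'v::euclidean_space metric \<Rightarrow> 'v \<Rightarrow> 'v \<Rightarrow> 'v \<Rightarrow> real" where
  "mean_curvature g a p N =
     (\<Sum>e\<in>(SOME B. orthonormal_basis g a p B). second_fundamental_form g p N e e)"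

definition minimal_equator :: "'v::euclidean_space metric \<Rightarrow> 'v \<Rightarrow> bool" where
  "minimal_equator g a \<longleftrightarrow>
     (\<forall>p\<in>equator a. \<forall>N. unit_normal g a p N \<longrightarrow> mean_curvature g a p N = 0)"

definition equator_minimal_metrics :: "'v::euclidean_space metric set" where
  "equator_minimal_metrics = {g \<in> riemannian_metrics. \<forall>a. a \<noteq> 0 \<longrightarrow> minimal_equator g a}"


section \<open>Algebraic curvature tensors\<close>

type_synonym 'v tensor4 = "'v \<Rightarrow> 'v \<Rightarrow> 'v \<Rightarrow> 'v \<Rightarrow> real"

definition algebraic_curvature_tensor :: "'v::euclidean_space tensor4 \<Rightarrow> bool" where
  "algebraic_curvature_tensor R \<longleftrightarrow>
     (\<forall>y z w. linear (\<lambda>x. R x y z w)) \<and> (\<forall>x z w. linear (\<lambda>y. R x y z w)) \<and>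
     (\<forall>x y w. linear (\<lambda>z. R x y z w)) \<and> (\<forall>x y z. linear (\<lambda>w. R x y z w)) \<and>
     (\<forall>x y z w. R x y z w = - R y x z w \<and> R x y z w = - R x y w z \<and> R x y z w = R z w x y \<and>
        R x y z w + R x z w y + R x w y z = 0)"

definition positive_curvature_tensors :: "'v::euclidean_space tensor4 set" where
  "positive_curvature_tensors = {R. algebraic_curvature_tensor R \<and>
     (\<forall>v w. norm v = 1 \<longrightarrow> norm w = 1 \<longrightarrow> v \<bullet> w = 0 \<longrightarrow> R v w v w > 0)}"


section \<open>The projective linear group and its actions\<close>

definition GL :: "(real^'m^'m::finite) monoid" where
  "GL = \<lparr>carrier = {T. invertible T}, monoid.mult = (**), one = mat 1\<rparr>"

definition PGL :: "(real^'m^'m::finite) set monoid" where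
  "PGL = GL Mod {mat c | c. c \<noteq> 0}"

definition sphere_map :: "real^'m^'m::finite \<Rightarrow> real^'m \<Rightarrow> real^'m" where
  "sphere_map T x = (T *v x) /\<^sub>R norm (T *v x)"

definition pullback_metric ::
    "('v::euclidean_space \<Rightarrow> 'v) \<Rightarrow> 'v metric \<Rightarrow> 'v metric" where
  "pullback_metric f g x u v =
     (if x \<in> unit_sphere \<and> u \<in> sphere_tangent x \<and> v \<in> sphere_tangent x
      then g (f x) (sphere_deriv f x u) (sphere_deriv f x v) else 0)"

definition transform_tensor :: "real^'m^'m::finite \<Rightarrow> (real^'m) tensor4 \<Rightarrow> (real^'m) tensor4" where
  "transform_tensor T R x y z w =
     1 / (\<bar>det T\<bar> powr (4 / real CARD('m))) * R (T *v x) (T *v y) (T *v z) (T *v w)"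

text \<open>The right actions of a class in \<open>PGL\<close>: the common value of the actions of its
  representatives.\<close>

definition metric_action :: "(real^'m::finite) metric \<Rightarrow> (real^'m^'m) set \<Rightarrow> (real^'m) metric" where
  "metric_action g C = the_elem ((\<lambda>T. pullback_metric (sphere_map T) g) ` C)"

definition tensor_action :: "(real^'m::finite) tensor4 \<Rightarrow> (real^'m^'m) set \<Rightarrow> (real^'m) tensor4" where
  "tensor_action R C = the_elem ((\<lambda>T. transform_tensor T R) ` C)"

end

theory Submission
  imports Defs
begin

text \<open>Write \<open>m\<close> for the dimension of the ambient space, so that the sphere has dimension
  \<open>n = m - 1\<close>. Differentiating a metric \<open>g\<close> componentwise (after projecting constant vectors to
  the tangent spaces) gives a three-tensor \<open>T X u v\<close>. Equators are totally geodesic for the round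
  metric, so by the Koszul formula the mean curvature of an equator with \<open>g\<close>-unit normal \<open>N\<close> is
  an expression \<open>\<beta> N - T N N N / 2\<close>, where \<open>\<beta>\<close> is a one-form made of the \<open>g\<close>-traces of \<open>T\<close>.
  Every unit vector is normal to some equator, so all equators are minimal if and only if
  \<open>T N N N = 2 * \<beta> N * g N N\<close> for all tangent \<open>N\<close>. Polarising and tracing this cubic identity
  determines \<open>\<beta>\<close>: it is \<open>1 / (n + 1)\<close> times the logarithmic derivative of the determinant of \<open>g\<close>
  with respect to the round metric. Hence minimality of all equators says exactly that the rescaled form
  \<open>k = det g powr (- 2 / (n + 1)) * g\<close> is a Killing tensor: \<open>(D\<^sub>N k) N N = 0\<close>
  (lemmas \<open>mean_curvature_eq\<close>, \<open>cubic_identity_trace\<close>, \<open>equator_minimal_iff_killing\<close>).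

  A Killing tensor is constant on the velocities of great circles. Therefore the homogeneous
  extension of \<open>k x v v\<close> to all pairs of vectors depends only on the bivector spanned by \<open>x\<close> and
  \<open>v\<close>; in particular it is symmetric in \<open>x\<close> and \<open>v\<close>, and being quadratic in \<open>v\<close> it is quadratic in
  \<open>x\<close> as well. Such a biquadratic form is \<open>R x v x v\<close> for exactly one algebraic curvature tensor
  \<open>R\<close>, and positivity of \<open>k\<close> is positivity of the sectional curvature of \<open>R\<close>
  (\<open>killing_biquadratic_symmetric\<close>, \<open>curvature_of_biquadratic\<close>, \<open>killing_form_curvature\<close>).

  Conversely every \<open>R\<close> of positive sectional curvature yields a Killing tensor \<open>R x u x v\<close>, and for
  \<open>n \<ge> 2\<close> the rescaling can be undone, since the determinant of \<open>k\<close> is a nonzero power of that of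
  \<open>g\<close>: the metric is \<open>det k powr (2 / (1 - n)) * k\<close>. This map from tensors to metrics is inverse to
  the wanted correspondence. Its equivariance is a computation with the Jacobian
  \<open>\<bar>det T\<bar> / norm (T x) ^ (n + 1)\<close> of the projective map induced by \<open>T\<close>
  (\<open>tangent_det_pullback\<close>, \<open>curvature_metric_equivariant\<close>).\<close>

section \<open>Orthonormal bases and traces of bilinear forms\<close>

definition form_orthonormal :: "('v::euclidean_space \<Rightarrow> 'v \<Rightarrow> real) \<Rightarrow> 'v set \<Rightarrow> bool" where
  "form_orthonormal G B \<longleftrightarrow> (\<forall>u\<in>B. \<forall>v\<in>B. G u v = (if u = v then 1 else 0))"

text \<open>Gram-Schmidt for a form that need only be definite on \<open>S\<close>: normalise one vector and recurse into
  its \<open>G\<close>-complement in \<open>S\<close>.\<close>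

lemma form_orthonormal_basis_exists:
  fixes G :: "'v::euclidean_space \<Rightarrow> 'v \<Rightarrow> real"
  assumes bil: "bilinear G" and sym: "\<And>u v. G u v = G v u"
    and S: "subspace S" and pos: "\<And>u. u \<in> S \<Longrightarrow> u \<noteq> 0 \<Longrightarrow> G u u > 0"
  shows "\<exists>B. B \<subseteq> S \<and> span B = S \<and> form_orthonormal G B"
  unfolding form_orthonormal_def
  using S pos
proof (induction "dim S" arbitrary: S rule: less_induct)
  case less
  show ?case
  proof (cases "S \<subseteq> {0}")
    case True
    then have "S = {0}" using less.prems(1) subspace_0 by blast
    then show ?thesis by (intro exI[of _ "{}"]) auto
  next
    case False
    then obtain x where x: "x \<in> S" "x \<noteq> 0" by auto
    define e where "e = (1 / sqrt (G x x)) *\<^sub>R x"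
    have Gx: "G x x > 0" using less.prems(2) x by auto
    have e: "e \<in> S" unfolding e_def using less.prems(1) x by (simp add: subspace_scale)
    have Gee: "G e e = 1"
      unfolding e_def using Gx by (simp add: bilinear_lmul[OF bil] bilinear_rmul[OF bil])
    define S' where "S' = {u \<in> S. G u e = 0}"
    have sub': "subspace S'"
      using less.prems(1) unfolding S'_def subspace_def
      by (auto simp: bilinear_ladd[OF bil] bilinear_lmul[OF bil] bilinear_lzero[OF bil])
    have "e \<notin> S'" using Gee unfolding S'_def by simp
    then have "S' \<subset> S" using e unfolding S'_def by blast
    then have "dim S' < dim S"
      using dim_psubset[of S' S] sub' less.prems(1) by (metis span_eq_iff)
    then obtain B where B: "B \<subseteq> S'" "span B = S'" "\<forall>u\<in>B. \<forall>v\<in>B. G u v = (if u = v then 1 else 0)"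
      using less.hyps[of S'] sub' less.prems(2) unfolding S'_def by blast
    have "span (insert e B) = S"
    proof
      show "span (insert e B) \<subseteq> S"
        using B(1) e less.prems(1) unfolding S'_def by (intro span_minimal) auto
      show "S \<subseteq> span (insert e B)"
      proof
        fix u assume u: "u \<in> S"
        have "u - G u e *\<^sub>R e \<in> S'"
          unfolding S'_def using u e less.prems(1) Gee
          by (auto simp: subspace_diff subspace_scale bilinear_lsub[OF bil] bilinear_lmul[OF bil])
        then have "u - G u e *\<^sub>R e \<in> span (insert e B)"
          using B(2) span_mono[of B "insert e B"] by blast
        moreover have "G u e *\<^sub>R e \<in> span (insert e B)"
          by (simp add: span_base span_scale)
        ultimately show "u \<in> span (insert e B)" using span_add by fastforce
      qed
    qed
    moreover have "G e v = 0" "G v e = 0" "v \<noteq> e" if "v \<in> B" for v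
      using that B(1) Gee sym[of v e] unfolding S'_def by auto
    ultimately show ?thesis
      using B e Gee unfolding S'_def by (intro exI[of _ "insert e B"]) auto
  qed
qed

lemma form_orthonormal_independent:
  fixes G :: "'v::euclidean_space \<Rightarrow> 'v \<Rightarrow> real"
  assumes bil: "bilinear G" and on: "form_orthonormal G B"
  shows "independent B"
  unfolding independent_explicit_finite_subsets
proof (intro allI impI ballI)
  fix A c w assume A: "A \<subseteq> B" "finite A" "(\<Sum>v\<in>A. c v *\<^sub>R v) = 0" "w \<in> A"
  have "0 = G (\<Sum>v\<in>A. c v *\<^sub>R v) w"
    using A(3) bilinear_lzero[OF bil] by simp
  also have "\<dots> = (\<Sum>v\<in>A. c v * G v w)"
    using bil unfolding bilinear_def by (simp add: linear_sum[of "\<lambda>x. G x w"] linear_scale[of "\<lambda>x. G x w"])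
  also have "\<dots> = (\<Sum>v\<in>A. if v = w then c v else 0)"
    using A on by (intro sum.cong) (auto simp: form_orthonormal_def subset_iff)
  finally show "c w = 0" using A by simp
qed

lemma form_orthonormal_finite:
  fixes G :: "'v::euclidean_space \<Rightarrow> 'v \<Rightarrow> real"
  assumes bil: "bilinear G" and on: "form_orthonormal G B"
  shows "finite B" "card B = dim (span B)"
proof -
  have "independent B" by (rule form_orthonormal_independent[OF assms])
  then show "finite B" "card B = dim (span B)"
    by (simp_all add: independent_imp_finite dim_span_eq_card_independent del: dim_span)
qed

lemma form_orthonormal_expand:
  fixes G :: "'v::euclidean_space \<Rightarrow> 'v \<Rightarrow> real"
  assumes bil: "bilinear G" and on: "form_orthonormal G B" and u: "u \<in> span B"
  shows "u = (\<Sum>e\<in>B. G u e *\<^sub>R e)"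
  using u
proof (induction rule: span_induct)
  have fin: "finite B" using form_orthonormal_finite[OF bil on] by simp
  have scale: "c *\<^sub>R x = (\<Sum>e\<in>B. (c * G x e) *\<^sub>R e)" if "x = (\<Sum>e\<in>B. G x e *\<^sub>R e)" for c x
  proof -
    have "(\<Sum>e\<in>B. (c * G x e) *\<^sub>R e) = c *\<^sub>R (\<Sum>e\<in>B. G x e *\<^sub>R e)"
      by (simp add: scaleR_sum_right)
    then show ?thesis using that by simp
  qed
  show "subspace {a. a = (\<Sum>e\<in>B. G a e *\<^sub>R e)}"
    unfolding subspace_def
    by (auto intro!: scale simp: bilinear_lzero[OF bil] bilinear_ladd[OF bil] bilinear_lmul[OF bil]
        scaleR_left_distrib sum.distrib)
  fix x assume x: "x \<in> B"
  have "(\<Sum>e\<in>B. G x e *\<^sub>R e) = (\<Sum>e\<in>B. if x = e then e else 0)"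
    using x on by (intro sum.cong) (auto simp: form_orthonormal_def)
  then show "x = (\<Sum>e\<in>B. G x e *\<^sub>R e)" using x fin by simp
qed

lemma bilinear_sum_expand:
  fixes b :: "'v::euclidean_space \<Rightarrow> 'w::euclidean_space \<Rightarrow> real"
  assumes "bilinear b"
  shows "b (\<Sum>i\<in>A. c i *\<^sub>R f i) (\<Sum>j\<in>C. d j *\<^sub>R h j) = (\<Sum>i\<in>A. \<Sum>j\<in>C. c i * d j * b (f i) (h j))"
proof -
  have l: "linear (\<lambda>x. b x y)" "linear (\<lambda>y. b x y)" for x y
    using assms unfolding bilinear_def by auto
  have "b (\<Sum>i\<in>A. c i *\<^sub>R f i) (\<Sum>j\<in>C. d j *\<^sub>R h j)
      = (\<Sum>i\<in>A. c i * b (f i) (\<Sum>j\<in>C. d j *\<^sub>R h j))"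
    by (simp only: linear_sum[OF l(1)] linear_scale[OF l(1)] real_scaleR_def)
  also have "\<dots> = (\<Sum>i\<in>A. c i * (\<Sum>j\<in>C. d j * b (f i) (h j)))"
    by (simp only: linear_sum[OF l(2)] linear_scale[OF l(2)] real_scaleR_def)
  finally show ?thesis by (simp add: sum_distrib_left mult_ac)
qed

text \<open>The mean curvature is a sum over an unspecified orthonormal basis of an equator; this lemma
  replaces that basis, completed by the normal, by one basis that serves for all normals.\<close>

lemma form_trace_independent:
  fixes G b :: "'v::euclidean_space \<Rightarrow> 'v \<Rightarrow> real"
  assumes bilG: "bilinear G" and sym: "\<And>u v. G u v = G v u" and bil: "bilinear b"
    and B: "form_orthonormal G B" and C: "form_orthonormal G C" and sp: "span B = span C"
  shows "(\<Sum>e\<in>B. b e e) = (\<Sum>e\<in>C. b e e)"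
proof -
  have fin: "finite B" "finite C" using form_orthonormal_finite[OF bilG] B C by auto
  have "(\<Sum>e\<in>B. b e e) = (\<Sum>e\<in>B. \<Sum>f\<in>C. \<Sum>h\<in>C. G e f * G e h * b f h)"
  proof (rule sum.cong[OF refl])
    fix e assume e: "e \<in> B"
    then have "e \<in> span C" using sp span_base by blast
    note x = form_orthonormal_expand[OF bilG C this]
    show "b e e = (\<Sum>f\<in>C. \<Sum>h\<in>C. G e f * G e h * b f h)"
      by (rule trans[OF arg_cong2[where f = b, OF x x] bilinear_sum_expand[OF bil]])
  qed
  also have "\<dots> = (\<Sum>f\<in>C. \<Sum>h\<in>C. (\<Sum>e\<in>B. G e f * G e h) * b f h)"
    by (subst sum.swap, rule sum.cong[OF refl], subst sum.swap) (simp add: sum_distrib_right)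
  also have "\<dots> = (\<Sum>f\<in>C. \<Sum>h\<in>C. G f h * b f h)"
  proof (intro sum.cong[OF refl])
    fix f h assume f: "f \<in> C" and h: "h \<in> C"
    then have "f \<in> span B" using sp span_base by blast
    note x = form_orthonormal_expand[OF bilG B this]
    have "G f h = G (\<Sum>e\<in>B. G f e *\<^sub>R e) h"
      by (rule arg_cong[where f = "\<lambda>x. G x h", OF x])
    also have "\<dots> = (\<Sum>e\<in>B. G f e * G e h)"
      using bilG unfolding bilinear_def by (simp add: linear_sum[of "\<lambda>x. G x h"] linear_scale[of "\<lambda>x. G x h"])
    finally show "(\<Sum>e\<in>B. G e f * G e h) * b f h = G f h * b f h" using sym by simp
  qed
  also have "\<dots> = (\<Sum>f\<in>C. \<Sum>h\<in>C. if f = h then b f h else 0)"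
    using C by (intro sum.cong) (auto simp: form_orthonormal_def)
  also have "\<dots> = (\<Sum>e\<in>C. b e e)" using fin by simp
  finally show ?thesis .
qed

text \<open>Existence and uniqueness of the vector that the Koszul formula describes.\<close>

lemma form_riesz:
  fixes G :: "'v::euclidean_space \<Rightarrow> 'v \<Rightarrow> real"
  assumes bil: "bilinear G" and sym: "\<And>u v. G u v = G v u"
    and S: "subspace S" and pos: "\<And>u. u \<in> S \<Longrightarrow> u \<noteq> 0 \<Longrightarrow> G u u > 0" and l: "linear l"
  shows "\<exists>!w. w \<in> S \<and> (\<forall>z\<in>S. G w z = l z)"
proof -
  obtain B where B: "B \<subseteq> S" "span B = S" and on: "form_orthonormal G B"
    using form_orthonormal_basis_exists[OF bil sym S pos] by blast
  define w where "w = (\<Sum>e\<in>B. l e *\<^sub>R e)"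
  have lin: "linear (\<lambda>x. G x z)" for z using bil by (simp add: bilinear_def)
  have "G w z = l z" if z: "z \<in> S" for z
  proof -
    have "G w z = (\<Sum>e\<in>B. G z e * l e)"
      unfolding w_def by (simp add: linear_sum[OF lin] linear_scale[OF lin] sym[of z] mult.commute)
    also have "\<dots> = l (\<Sum>e\<in>B. G z e *\<^sub>R e)"
      by (simp only: linear_sum[OF l] linear_scale[OF l] real_scaleR_def)
    also have "\<dots> = l z" using form_orthonormal_expand[OF bil on, of z] z B(2) by simp
    finally show ?thesis .
  qed
  moreover have "w \<in> S" unfolding w_def using B(1) S by (intro subspace_sum subspace_scale) auto
  moreover have "w' = w''" if "w' \<in> S" "\<forall>z\<in>S. G w' z = l z" "w'' \<in> S" "\<forall>z\<in>S. G w'' z = l z" for w' w''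
  proof (rule ccontr)
    assume "w' \<noteq> w''"
    then have "G (w' - w'') (w' - w'') > 0" using that S by (intro pos subspace_diff) auto
    moreover have "w' - w'' \<in> S" using that S by (intro subspace_diff) auto
    ultimately show False using that by (simp add: bilinear_lsub[OF bil])
  qed
  ultimately show ?thesis by blast
qed

lemma form_orthonormal_trace:
  assumes bil: "bilinear G" and on: "form_orthonormal G E" and l: "linear l" and X: "X \<in> span E"
  shows "(\<Sum>e\<in>E. l e * G X e) = l X"
proof -
  have "(\<Sum>e\<in>E. l e * G X e) = l (\<Sum>e\<in>E. G X e *\<^sub>R e)"
    by (simp add: linear_sum[OF l] linear_scale[OF l] mult.commute)
  also have "\<dots> = l X" using form_orthonormal_expand[OF bil on X] by simp
  finally show ?thesis .
qed

text \<open>The polarised identity is \<open>T X Y Y + 2 * T Y Y X = 2 * (l X * G Y Y + 2 * l Y * G X Y)\<close>; the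
  lemma is its trace over \<open>Y\<close>. It ties a one-form in such a cubic identity to the two traces of
  \<open>T\<close>, and is used in both directions of the characterisation of minimality.\<close>

lemma cubic_identity_trace:
  fixes G :: "'v::euclidean_space \<Rightarrow> 'v \<Rightarrow> real"
  assumes bil: "bilinear G" and sym: "\<And>u v. G u v = G v u" and on: "form_orthonormal G E"
    and T1: "\<And>u v. linear (\<lambda>X. T X u v)" and T2: "\<And>X. bilinear (T X)" and Ts: "\<And>X u v. T X u v = T X v u"
    and l: "linear l" and id: "\<And>N. N \<in> span E \<Longrightarrow> T N N N = 2 * l N * G N N" and X: "X \<in> span E"
  shows "(\<Sum>e\<in>E. T X e e) + 2 * (\<Sum>e\<in>E. T e e X) = 2 * (real (card E) + 2) * l X"
proof -
  have pol: "T X Y Y + 2 * T Y Y X = 2 * (l X * G Y Y + 2 * l Y * G X Y)" if Y: "Y \<in> span E" for Y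
  proof -
    \<comment> \<open>The odd part in \<open>X\<close> of the identity at \<open>Y + X\<close> is its linear part in \<open>X\<close> plus the identity at \<open>X\<close>.\<close>
    have a: "T (Y + X) (Y + X) (Y + X) = 2 * l (Y + X) * G (Y + X) (Y + X)"
      "T (Y - X) (Y - X) (Y - X) = 2 * l (Y - X) * G (Y - X) (Y - X)"
      "T X X X = 2 * l X * G X X"
      using X Y by (auto intro!: id span_add span_diff)
    note t1 = linear_add[OF T1] linear_diff[OF T1]
      and t2 = bilinear_ladd[OF T2] bilinear_lsub[OF T2] bilinear_radd[OF T2] bilinear_rsub[OF T2]
      and g = bilinear_ladd[OF bil] bilinear_lsub[OF bil] bilinear_radd[OF bil] bilinear_rsub[OF bil]
      and ll = linear_add[OF l] linear_diff[OF l]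
    have s: "T Y X Y = T Y Y X" "T X X Y = T X Y X" "G Y X = G X Y" using Ts sym by auto
    show ?thesis using a unfolding t1 t2 g ll s by (simp add: algebra_simps)
  qed
  have "(\<Sum>e\<in>E. T X e e) + 2 * (\<Sum>e\<in>E. T e e X) = (\<Sum>e\<in>E. T X e e + 2 * T e e X)"
    by (simp add: sum.distrib sum_distrib_left)
  also have "\<dots> = (\<Sum>e\<in>E. 2 * (l X + 2 * (l e * G X e)))"
    using on by (intro sum.cong refl) (simp add: pol span_base form_orthonormal_def)
  also have "\<dots> = 2 * (real (card E) * l X + 2 * (\<Sum>e\<in>E. l e * G X e))"
    by (simp add: sum.distrib sum_distrib_left)
  also have "\<dots> = 2 * (real (card E) + 2) * l X"
    unfolding form_orthonormal_trace[OF bil on l X] by (simp add: algebra_simps)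
  finally show ?thesis .
qed

lemma subspace_sphere_tangent: "subspace (sphere_tangent x)"
  by (auto simp: subspace_def sphere_tangent_def inner_add_left)

section \<open>Determinants of forms on tangent spaces\<close>

lemma scalar_matrix_vector_mult: "mat c *v u = c *\<^sub>R u" for u :: "real^'n"
  by (simp add: vec_eq_iff matrix_vector_mult_def mat_def if_distrib if_distribR cong: if_cong)

lemma det_scalar_matrix: "det (mat c :: real^'n^'n) = c ^ CARD('n)"
  by (subst det_diagonal) (auto simp: mat_def)

lemma rank_one_update_mult:
  fixes x y w :: "real^'n"
  shows "(\<chi> i j. (if i = j then 1 else 0) + x $ i * y $ j) *v w = w + (y \<bullet> w) *\<^sub>R x"
proof -
  have "(\<Sum>j\<in>UNIV. ((if i = j then 1 else 0) + x $ i * y $ j) * w $ j) = w $ i + (y \<bullet> w) * x $ i" for i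
  proof -
    have "(\<Sum>j\<in>UNIV. ((if i = j then 1 else 0) + x $ i * y $ j) * w $ j)
        = (\<Sum>j\<in>UNIV. if i = j then w $ j else 0) + (\<Sum>j\<in>UNIV. x $ i * (y $ j * w $ j))"
      by (simp only: sum.distrib[symmetric]) (rule sum.cong, auto simp: algebra_simps)
    then show ?thesis by (simp add: sum_distrib_left[symmetric] inner_vec_def)
  qed
  then show ?thesis by (simp add: vec_eq_iff matrix_vector_mult_def)
qed

text \<open>An orthogonal change of coordinates makes \<open>v\<close> a multiple of a coordinate vector; then only one
  column differs from the identity matrix and Cramer's rule applies.\<close>

lemma det_identity_plus_rank_one:
  fixes u v :: "real^'n"
  shows "det (\<chi> i j. (if i = j then 1 else 0) + u $ i * v $ j) = 1 + u \<bullet> v"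
proof -
  fix k :: 'n
  obtain f where f: "orthogonal_transformation f" "f (axis k (norm v)) = v"
  proof -
    have "norm (axis k (norm v)) = norm v"
      by (simp add: norm_eq_sqrt_inner inner_axis_axis)
    then show ?thesis using orthogonal_transformation_exists[of "axis k (norm v)" v] that by auto
  qed
  define Q where "Q = matrix f"
  have Q: "orthogonal_matrix Q" and Qw: "Q *v w = f w" for w
    using f(1) orthogonal_transformation_matrix[of f] unfolding Q_def
    by (auto simp: matrix_works)
  define u' where "u' = transpose Q *v u"
  define A :: "real^'n^'n" where "A = (\<chi> i j. (if i = j then 1 else 0) + u $ i * v $ j)"
  define A' :: "real^'n^'n" where "A' = (\<chi> i j. (if i = j then 1 else 0) + u' $ i * axis k (norm v) $ j)"
  have Aw: "A *v w = w + (v \<bullet> w) *\<^sub>R u" for w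
    unfolding A_def by (rule rank_one_update_mult)
  have A'w: "A' *v w = w + (axis k (norm v) \<bullet> w) *\<^sub>R u'" for w
    unfolding A'_def by (rule rank_one_update_mult)
  have "transpose Q ** A ** Q *v w = A' *v w" for w
  proof -
    have tQ: "transpose Q *v (Q *v x) = x" for x
      using Q by (simp add: matrix_vector_mul_assoc orthogonal_matrix_def)
    have "v \<bullet> (Q *v w) = axis k (norm v) \<bullet> w"
      using f Qw unfolding orthogonal_transformation_def by metis
    then have "transpose Q *v (A *v (Q *v w)) = transpose Q *v (Q *v w) + (axis k (norm v) \<bullet> w) *\<^sub>R u'"
      by (simp only: Aw matrix_vector_right_distrib matrix_vector_mult_scaleR u'_def)
    then show ?thesis unfolding tQ A'w by (simp add: matrix_vector_mul_assoc matrix_mul_assoc)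
  qed
  then have eq: "transpose Q ** A ** Q = A'" by (simp add: matrix_eq)
  have "det Q * det Q = 1"
    using det_orthogonal_matrix[OF Q] by auto
  then have "det A = det A'"
    by (simp add: eq[symmetric] det_mul det_transpose)
  also have "A' = (\<chi> i j. if j = k then (mat 1 *v ((\<chi> i. if i = k then 1 else 0) + norm v *\<^sub>R u')) $ i else (mat 1 :: real^'n^'n) $ i $ j)"
    unfolding A'_def matrix_vector_mul_lid by (auto simp: vec_eq_iff axis_def mat_def)
  also have "det \<dots> = ((\<chi> i. if i = k then 1 else 0) + norm v *\<^sub>R u') $ k * det (mat 1 :: real^'n^'n)"
    by (rule cramer_lemma)
  also have "\<dots> = 1 + u' \<bullet> axis k (norm v)"
    by (simp add: inner_axis)
  also have "u' \<bullet> axis k (norm v) = u \<bullet> v"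
    using f(2) unfolding u'_def by (metis dot_lmul_matrix vector_transpose_matrix Qw transpose_transpose)
  finally show ?thesis unfolding A_def .
qed

definition form_matrix :: "(real^'m \<Rightarrow> real^'m \<Rightarrow> real) \<Rightarrow> real^'m^'m" where
  "form_matrix h = (\<chi> i j. h (axis i 1) (axis j 1))"

lemma form_matrix_congruence:
  fixes L :: "real^'m^'m"
  assumes "bilinear h"
  shows "form_matrix (\<lambda>u v. h (L *v u) (L *v v)) = transpose L ** form_matrix h ** L"
proof -
  have "h (L *v axis i 1) (L *v axis j 1) = (\<Sum>k\<in>UNIV. \<Sum>l\<in>UNIV. L$k$i * L$l$j * h (axis k 1) (axis l 1))" for i j
  proof -
    have *: "L *v axis i 1 = (\<Sum>k\<in>UNIV. (L$k$i) *\<^sub>R axis k 1)" for i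
      by (simp add: vec_eq_iff matrix_vector_mult_def axis_def if_distrib cong: if_cong)
    show ?thesis unfolding * by (rule bilinear_sum_expand[OF assms])
  qed
  moreover have "(transpose L ** form_matrix h ** L) $ i $ j
      = (\<Sum>k\<in>UNIV. \<Sum>l\<in>UNIV. L$k$i * L$l$j * h (axis k 1) (axis l 1))" for i j
    unfolding form_matrix_def
    by (subst sum.swap) (simp add: matrix_matrix_mult_def transpose_def sum_distrib_left sum_distrib_right mult_ac)
  ultimately show ?thesis by (simp add: vec_eq_iff form_matrix_def)
qed

lemma det_form_congruence:
  fixes L :: "real^'m^'m"
  assumes "bilinear h"
  shows "det (form_matrix (\<lambda>u v. h (L *v u) (L *v v))) = det L ^ 2 * det (form_matrix h)"
  by (simp add: form_matrix_congruence[OF assms] det_mul det_transpose power2_eq_square)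
text \<open>In the Leibniz expansion the derivative of the product for a permutation \<open>p\<close> vanishes at the
  identity matrix unless \<open>p\<close> fixes all indices but one, that is, unless \<open>p\<close> is the identity.\<close>

lemma has_derivative_det_at_identity:
  fixes A :: "'w::real_normed_vector \<Rightarrow> real^'n^'n"
  assumes d: "\<And>i j. ((\<lambda>s. A s $ i $ j) has_derivative A' i j) (at t)" and I: "A t = mat 1"
  shows "((\<lambda>s. det (A s)) has_derivative (\<lambda>h. \<Sum>i\<in>UNIV. A' i i h)) (at t)"
proof -
  let ?P = "{p. p permutes (UNIV :: 'n set)}"
  have fin: "finite ?P" by (simp add: finite_permutations)
  have "((\<lambda>s. \<Sum>p\<in>?P. of_int (sign p) * (\<Prod>i\<in>UNIV. A s $ i $ p i)) has_derivative
    (\<lambda>h. \<Sum>p\<in>?P. of_int (sign p) * (\<Sum>i\<in>UNIV. A' i (p i) h * (\<Prod>j\<in>UNIV - {i}. A t $ j $ p j)))) (at t)"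
    by (intro has_derivative_sum has_derivative_mult_right has_derivative_prod d)
  moreover have "(\<Sum>p\<in>?P. of_int (sign p) * (\<Sum>i\<in>UNIV. A' i (p i) h * (\<Prod>j\<in>UNIV - {i}. A t $ j $ p j)))
      = (\<Sum>i\<in>UNIV. A' i i h)" for h
  proof -
    have z: "(\<Prod>j\<in>UNIV - {i}. A t $ j $ p j) = (if p = id then 1 else 0)" if p: "p permutes UNIV" for p i
    proof (cases "\<forall>j\<in>UNIV - {i}. p j = j")
      case True
      have "p i = i"
      proof (rule ccontr)
        assume "p i \<noteq> i"
        then have "p (p i) = p i" using True by auto
        then show False using permutes_inj[OF p] \<open>p i \<noteq> i\<close> by (auto dest: injD)
      qed
      then have "p = id" using True by (auto simp: fun_eq_iff)
      then show ?thesis by (simp add: I mat_def)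
    next
      case False
      then obtain j where "j \<noteq> i" "p j \<noteq> j" by auto
      then have "(\<Prod>j\<in>UNIV - {i}. A t $ j $ p j) = 0" 
        by (intro prod_zero bexI[of _ j]) (auto simp: I mat_def)
      then show ?thesis using \<open>p j \<noteq> j\<close> by auto
    qed
    have "(\<Sum>p\<in>?P. of_int (sign p) * (\<Sum>i\<in>UNIV. A' i (p i) h * (\<Prod>j\<in>UNIV - {i}. A t $ j $ p j)))
      = (\<Sum>p\<in>?P. if p = id then (\<Sum>i\<in>UNIV. A' i i h) else 0)"
      by (rule sum.cong) (auto simp: z sign_id)
    also have "\<dots> = (\<Sum>i\<in>UNIV. A' i i h)" using fin permutes_id by simp
    finally show ?thesis .
  qed
  ultimately show ?thesis unfolding det_def by simp
qed

text \<open>The forms of interest live on the tangent space at \<open>x\<close> and are extended by zero along \<open>x\<close>. Adding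
  the square of the \<open>x\<close>-component makes them nondegenerate, so that the determinant on the
  tangent space becomes the determinant of a square matrix indexed like the ambient space.\<close>

definition filled_form :: "('v::euclidean_space \<Rightarrow> 'v \<Rightarrow> real) \<Rightarrow> 'v \<Rightarrow> 'v \<Rightarrow> 'v \<Rightarrow> real" where
  "filled_form h x u v = h u v + (x \<bullet> u) * (x \<bullet> v)"

definition tangent_det :: "(real^'m \<Rightarrow> real^'m \<Rightarrow> real) \<Rightarrow> real^'m \<Rightarrow> real" where
  "tangent_det h x = det (form_matrix (filled_form h x))"

lemma filled_form_bilinear: "bilinear h \<Longrightarrow> bilinear (filled_form h x)"
  unfolding bilinear_def filled_form_def
  by (auto simp: linear_iff inner_add_right algebra_simps)

text \<open>The columns of \<open>L\<close> are the orthonormal basis of the tangent space together with \<open>x\<close> itself.\<close>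

lemma adapted_matrix_exists:
  fixes x :: "real^'m"
  assumes g: "bilinear h" and x: "norm x = 1" and on: "form_orthonormal h E" and s: "span E = sphere_tangent x"
    and hx: "\<And>u. h x u = 0" "\<And>u. h u x = 0"
  shows "\<exists>(L :: real^'m^'m) f. bij_betw f UNIV (insert x E) \<and> (\<forall>i. L *v axis i 1 = f i) \<and>
    form_matrix (\<lambda>u v. filled_form h x (L *v u) (L *v v)) = mat 1"
proof -
  have xx: "x \<bullet> x = 1" using x by (simp add: dot_square_norm)
  have Ex: "x \<bullet> e = 0" if "e \<in> E" for e
    using that s span_base[of e E] by (simp add: sphere_tangent_def inner_commute)
  then have xE: "x \<notin> E" using xx by force
  have finE: "finite E" by (rule form_orthonormal_finite(1)[OF g on])
  have "x \<noteq> 0" using x by auto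
  have "sphere_tangent x = {y. x \<bullet> y = 0}" by (auto simp: sphere_tangent_def inner_commute)
  then have "card E = CARD('m) - 1"
    using dim_hyperplane[OF \<open>x \<noteq> 0\<close>] s form_orthonormal_finite(2)[OF g on] by simp
  moreover have "CARD('m) \<ge> 1" by (simp add: Suc_le_eq)
  ultimately have "card (insert x E) = CARD('m)" using finE xE by simp
  then obtain f where f: "bij_betw f (UNIV :: 'm set) (insert x E)"
    using finite_same_card_bij[of "UNIV :: 'm set" "insert x E"] finE by auto
  define L :: "real^'m^'m" where "L = (\<chi> i j. f j $ i)"
  have L: "L *v axis i 1 = f i" for i
    by (simp add: L_def vec_eq_iff matrix_vector_mult_def axis_def if_distrib cong: if_cong)
  have "filled_form h x u v = (if u = v then 1 else 0)" if "u \<in> insert x E" "v \<in> insert x E" for u v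
    using that on Ex hx xx xE by (auto simp: filled_form_def form_orthonormal_def)
  moreover have "f i \<in> insert x E" "f i = f j \<longleftrightarrow> i = j" for i j
    using f by (auto simp: bij_betw_def inj_on_def)
  ultimately have "form_matrix (\<lambda>u v. filled_form h x (L *v u) (L *v v)) = mat 1"
    by (simp add: form_matrix_def L mat_def vec_eq_iff)
  then show ?thesis using f L by blast
qed

text \<open>How the tangential determinant changes under a linear map \<open>T\<close> that sends \<open>x\<close> to a multiple of
  another point of the sphere. The congruence by \<open>T\<close> turns the rank one term \<open>x \<otimes> x\<close> into
  \<open>\<xi> \<otimes> \<xi>\<close> with \<open>\<xi> \<bullet> y = 1\<close>, where one wants \<open>\<eta> \<otimes> \<eta>\<close> with \<open>\<eta> = y / norm y\<close>. Since \<open>y\<close> spans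
  the kernel of \<open>h\<close>, the shear \<open>L u = u + (c \<bullet> u) y\<close> preserves \<open>h\<close> and can be chosen to carry one rank
  one term to the other.\<close>

lemma tangent_det_pullback:
  fixes T :: "real^'m^'m"
  assumes h: "bilinear h" and T: "invertible T" and x: "norm x = 1"
    and y: "y = T *v x" and hy: "\<And>u. h y u = 0" "\<And>u. h u y = 0"
  shows "tangent_det (\<lambda>u v. h (T *v u) (T *v v)) x = (det T / norm y)\<^sup>2 * tangent_det h (y /\<^sub>R norm y)"
proof -
  have xx: "x \<bullet> x = 1" using x by (simp add: dot_square_norm)
  obtain T' where "T' ** T = mat 1" using T unfolding invertible_def by blast
  then have TT: "T' *v (T *v u) = u" for u
    by (simp add: matrix_vector_mul_assoc)
  have y0: "y \<noteq> 0"
  proof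
    assume "y = 0"
    then have "x = 0" using TT[of x] y by simp
    then show False using x by simp
  qed
  \<comment> \<open>The covector with \<open>\<xi> \<bullet> T u = x \<bullet> u\<close>.\<close>
  define \<xi> where "\<xi> = x v* T'"
  have \<xi>: "\<xi> \<bullet> (T *v u) = x \<bullet> u" for u
    by (simp add: \<xi>_def dot_lmul_matrix TT)
  have \<xi>y: "\<xi> \<bullet> y = 1" using \<xi>[of x] xx y by simp
  define \<eta> where "\<eta> = y /\<^sub>R norm y"
  have \<eta>y: "\<eta> \<bullet> y = norm y" using y0 by (simp add: \<eta>_def dot_square_norm power2_eq_square)
  define c where "c = (\<xi> - \<eta>) /\<^sub>R norm y"
  define L :: "real^'m^'m" where "L = (\<chi> i j. (if i = j then 1 else 0) + y $ i * c $ j)"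
  have L: "L *v u = u + (c \<bullet> u) *\<^sub>R y" for u unfolding L_def by (rule rank_one_update_mult)
  have detL: "det L = 1 / norm y"
    unfolding L_def det_identity_plus_rank_one using \<xi>y \<eta>y y0
    by (simp add: c_def inner_commute[of y] inner_diff_left field_simps)
  have h': "filled_form h \<eta> (L *v u) (L *v v) = filled_form h \<xi> u v" for u v
  proof -
    have "\<eta> \<bullet> (L *v u) = \<xi> \<bullet> u" for u
      unfolding L using y0 \<eta>y by (simp add: inner_add_right c_def inner_diff_left field_simps)
    moreover have "h (L *v u) (L *v v) = h u v"
      unfolding L by (simp add: bilinear_ladd[OF h] bilinear_radd[OF h] bilinear_lmul[OF h] bilinear_rmul[OF h] hy)
    ultimately show ?thesis by (simp add: filled_form_def)
  qed
  have "tangent_det (\<lambda>u v. h (T *v u) (T *v v)) x = det (form_matrix (\<lambda>u v. filled_form h \<xi> (T *v u) (T *v v)))"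
    by (simp add: tangent_det_def filled_form_def[abs_def] \<xi>)
  also have "\<dots> = det T ^ 2 * det (form_matrix (filled_form h \<xi>))"
    by (rule det_form_congruence[OF filled_form_bilinear[OF h]])
  also have "form_matrix (filled_form h \<xi>) = form_matrix (\<lambda>u v. filled_form h \<eta> (L *v u) (L *v v))"
    by (simp add: h')
  also have "det \<dots> = det L ^ 2 * tangent_det h \<eta>"
    unfolding tangent_det_def by (rule det_form_congruence[OF filled_form_bilinear[OF h]])
  finally show ?thesis by (simp add: detL \<eta>_def power_divide)
qed

text \<open>The case of a homothety: its determinant counts one dimension too many, and the norm of the image
  of \<open>x\<close> removes it.\<close>

lemma tangent_det_scale:
  fixes x :: "real^'m"
  assumes h: "bilinear h" and x: "norm x = 1" and c: "c > 0" and hx: "\<And>u. h x u = 0" "\<And>u. h u x = 0"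
  shows "tangent_det (\<lambda>u v. c * h u v) x = c ^ (CARD('m) - 1) * tangent_det h x"
proof -
  define s where "s = sqrt c"
  have s: "s > 0" "c = s * s" using c by (auto simp: s_def)
  note ms = scalar_matrix_vector_mult[of s] and det = det_scalar_matrix[of s, where 'n = 'm]
  have inv: "invertible (mat s :: real^'m^'m)" using s det by (simp add: invertible_det_nz)
  have "tangent_det (\<lambda>u v. h (mat s *v u) (mat s *v v)) x
      = (det (mat s :: real^'m^'m) / norm (mat s *v x))\<^sup>2 * tangent_det h ((mat s *v x) /\<^sub>R norm (mat s *v x))"
    by (rule tangent_det_pullback[OF h inv x refl]) (simp_all add: ms bilinear_lmul[OF h] bilinear_rmul[OF h] hx)
  moreover have "(mat s *v x) /\<^sub>R norm (mat s *v x) = x" "norm (mat s *v x) = s" using s x by (simp_all add: ms)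
  moreover have "(\<lambda>u v. h (mat s *v u) (mat s *v v)) = (\<lambda>u v. c * h u v)"
    by (simp add: ms bilinear_lmul[OF h] bilinear_rmul[OF h] s(2) mult.assoc)
  moreover have "(s ^ CARD('m) / s)\<^sup>2 = c ^ (CARD('m) - 1)"
  proof -
    obtain k where k: "CARD('m) = Suc k" by (cases "CARD('m)") auto
    have "(s ^ Suc k / s)\<^sup>2 = (s ^ k)\<^sup>2" using s(1) by simp
    also have "\<dots> = (s * s) ^ k" by (simp add: power_mult_distrib power2_eq_square)
    finally show ?thesis unfolding k s(2) by simp
  qed
  ultimately show ?thesis by (simp add: det)
qed

lemma tangent_det_pos:
  fixes x :: "real^'m"
  assumes h: "bilinear h" and sym: "\<And>u v. h u v = h v u" and x: "norm x = 1"
    and hx: "\<And>u. h x u = 0" and pos: "\<And>u. u \<in> sphere_tangent x \<Longrightarrow> u \<noteq> 0 \<Longrightarrow> h u u > 0"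
  shows "tangent_det h x > 0"
proof -
  have "\<exists>E. E \<subseteq> sphere_tangent x \<and> span E = sphere_tangent x \<and> form_orthonormal h E"
    by (rule form_orthonormal_basis_exists[OF h sym subspace_sphere_tangent pos])
  then obtain E where on: "form_orthonormal h E" and s: "span E = sphere_tangent x" by auto
  have hx': "h u x = 0" for u using hx sym by simp
  obtain L :: "real^'m^'m" where "form_matrix (\<lambda>u v. filled_form h x (L *v u) (L *v v)) = mat 1"
    using adapted_matrix_exists[OF h x on s hx hx'] by auto
  then have "det L ^ 2 * tangent_det h x = 1"
    using det_form_congruence[OF filled_form_bilinear[OF h, of x], of L] by (simp add: tangent_det_def)
  moreover have "det L ^ 2 \<ge> 0" by simp
  ultimately show ?thesis by (metis mult_nonneg_nonpos not_le zero_less_one)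
qed

section \<open>Smooth functions on the sphere\<close>

lemma Ck_on_subset: "Ck_on k f U \<Longrightarrow> V \<subseteq> U \<Longrightarrow> Ck_on k f V"
  by (induction k arbitrary: f) (auto intro: continuous_on_subset)

lemma Ck_on_cong:
  assumes "open U" "\<And>x. x \<in> U \<Longrightarrow> f x = g x" "Ck_on k f U"
  shows "Ck_on k g U"
  using assms(2,3)
proof (induction k arbitrary: f g)
  case 0
  then show ?case using continuous_on_cong[of U U f g] by simp
next
  case (Suc k)
  have d: "(g has_derivative frechet_derivative f (at x)) (at x)" if x: "x \<in> U" for x
  proof (rule has_derivative_transform_within_open[OF _ assms(1) x Suc.prems(1)])
    have "f differentiable (at x)" using Suc.prems(2) x unfolding Ck_on.simps by blast
    then show "(f has_derivative frechet_derivative f (at x)) (at x)"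
      using frechet_derivative_works by blast
  qed
  then have eq: "frechet_derivative f (at x) = frechet_derivative g (at x)" if x: "x \<in> U" for x
    using x frechet_derivative_at by blast
  have "Ck_on k (\<lambda>x. frechet_derivative g (at x) v) U" for v
  proof (rule Suc.IH)
    show "Ck_on k (\<lambda>x. frechet_derivative f (at x) v) U" using Suc.prems(2) by simp
  qed (simp add: eq)
  then show ?case using d unfolding Ck_on.simps differentiable_def by blast
qed

text \<open>Allows any derivative found by the calculus rules in place of the chosen Frechet derivative.\<close>

lemma Ck_on_SucI:
  assumes U: "open U" and d: "\<And>x. x \<in> U \<Longrightarrow> (f has_derivative D x) (at x)" and "\<And>v. Ck_on k (\<lambda>x. D x v) U"
  shows "Ck_on (Suc k) f U"
proof -
  have "D x = frechet_derivative f (at x)" if "x \<in> U" for x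
    using d[OF that] frechet_derivative_at by blast
  then have "Ck_on k (\<lambda>x. frechet_derivative f (at x) v) U" for v
    by (intro Ck_on_cong[OF U _ assms(3)[of v]]) auto
  then show ?thesis using d unfolding Ck_on.simps differentiable_def by blast
qed

lemma Ck_on_SucD:
  assumes "Ck_on (Suc k) f U"
  shows "x \<in> U \<Longrightarrow> (f has_derivative frechet_derivative f (at x)) (at x)"
    "Ck_on k (\<lambda>x. frechet_derivative f (at x) v) U"
  using assms frechet_derivative_works by auto

lemma Ck_on_Suc_imp: "Ck_on (Suc k) f U \<Longrightarrow> Ck_on k f U"
proof (induction k arbitrary: f)
  case 0
  then show ?case
    by (auto intro!: continuous_at_imp_continuous_on differentiable_imp_continuous_within)
next
  case (Suc k)
  show ?case using Suc.prems Suc.IH unfolding Ck_on.simps(2)[of "Suc k" f] Ck_on.simps(2)[of k f] by blast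
qed

lemma Ck_on_const: "Ck_on k (\<lambda>x. c) U"
  by (induction k arbitrary: c) (auto simp: frechet_derivative_const)

lemma Ck_on_add:
  assumes U: "open U"
  shows "Ck_on k f U \<Longrightarrow> Ck_on k g U \<Longrightarrow> Ck_on k (\<lambda>x. f x + g x) U"
proof (induction k arbitrary: f g)
  case 0
  then show ?case by (auto intro: continuous_on_add)
next
  case (Suc k)
  show ?case
    by (rule Ck_on_SucI[OF U has_derivative_add[OF Ck_on_SucD(1)[OF Suc.prems(1)] Ck_on_SucD(1)[OF Suc.prems(2)]]])
      (auto intro: Suc.IH Ck_on_SucD(2)[OF Suc.prems(1)] Ck_on_SucD(2)[OF Suc.prems(2)])
qed

lemma Ck_on_bounded_linear:
  assumes L: "bounded_linear L" and U: "open U"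
  shows "Ck_on k f U \<Longrightarrow> Ck_on k (\<lambda>x. L (f x)) U"
proof (induction k arbitrary: f)
  case 0
  then show ?case using bounded_linear.continuous_on[OF L] by auto
next
  case (Suc k)
  show ?case
    by (rule Ck_on_SucI[OF U bounded_linear.has_derivative[OF L Ck_on_SucD(1)[OF Suc.prems]]])
      (auto intro: Suc.IH Ck_on_SucD(2)[OF Suc.prems])
qed

lemma Ck_on_id: "open U \<Longrightarrow> Ck_on k (\<lambda>x. x) U"
proof (cases k)
  case (Suc j)
  assume U: "open U"
  show ?thesis unfolding Suc by (rule Ck_on_SucI[OF U has_derivative_ident]) (rule Ck_on_const)
qed auto

lemma Ck_on_bilinear:
  assumes B: "bounded_bilinear B" and U: "open U"
  shows "Ck_on k f U \<Longrightarrow> Ck_on k g U \<Longrightarrow> Ck_on k (\<lambda>x. B (f x) (g x)) U"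
proof (induction k arbitrary: f g)
  case 0
  then show ?case using bounded_bilinear.continuous_on[OF B] by auto
next
  case (Suc k)
  show ?case
    by (rule Ck_on_SucI[OF U bounded_bilinear.FDERIV[OF B Ck_on_SucD(1)[OF Suc.prems(1)] Ck_on_SucD(1)[OF Suc.prems(2)]]])
      (auto intro!: Suc.IH Ck_on_add[OF U] Ck_on_SucD(2)[OF Suc.prems(1)] Ck_on_SucD(2)[OF Suc.prems(2)] 
         intro: Ck_on_Suc_imp[OF Suc.prems(1)] Ck_on_Suc_imp[OF Suc.prems(2)])
qed

lemma Ck_on_powr:
  fixes f :: "'v::euclidean_space \<Rightarrow> real"
  assumes U: "open U" and pos: "\<And>x. x \<in> U \<Longrightarrow> f x > 0"
  shows "Ck_on k f U \<Longrightarrow> Ck_on k (\<lambda>x. f x powr a) U"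
proof (induction k arbitrary: a)
  case 0
  then have "continuous_on U f" by simp
  then have "continuous_on U (\<lambda>x. f x powr a)"
    using pos by (intro continuous_on_powr continuous_on_const) force+
  then show ?case by simp
next
  case (Suc k)
  note f = Ck_on_Suc_imp[OF Suc.prems]
  have d: "((\<lambda>x. f x powr a) has_derivative (\<lambda>v. (a * f x powr (a - 1)) * frechet_derivative f (at x) v)) (at x)"
    if "x \<in> U" for x
  proof -
    have "((\<lambda>t. t powr a) has_derivative (\<lambda>h. h * (a * f x powr (a - 1)))) (at (f x))"
      using has_real_derivative_powr[of "f x" a] pos[OF that] by (simp add: has_field_derivative_def mult.commute[of _ "a * f x powr (a - 1)"])
    from diff_chain_at[OF Ck_on_SucD(1)[OF Suc.prems that] this] show ?thesis
      by (simp add: o_def mult_ac)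
  qed
  show ?case
    by (rule Ck_on_SucI[OF U d], assumption)
      (intro Ck_on_bilinear[OF bounded_bilinear_mult U] Ck_on_const Suc.IH[OF f] Ck_on_SucD(2)[OF Suc.prems])
qed

lemma smooth_onD:
  "smooth_on f S \<Longrightarrow> x \<in> S \<Longrightarrow> \<exists>U h. open U \<and> x \<in> U \<and> (\<forall>k. Ck_on k h U) \<and> (\<forall>y\<in>U \<inter> S. h y = f y)"
  unfolding smooth_on_def by (rule bspec)

lemma smooth_on_const: "smooth_on (\<lambda>x. c) S"
  unfolding smooth_on_def by (intro ballI exI[of _ UNIV] exI[of _ "\<lambda>x. c"]) (auto intro: Ck_on_const)

lemma smooth_on_id: "smooth_on (\<lambda>x. x) S"
  unfolding smooth_on_def by (intro ballI exI[of _ UNIV] exI[of _ "\<lambda>x. x"]) (auto intro: Ck_on_id)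

lemma smooth_on_cong: "smooth_on f S \<Longrightarrow> (\<And>x. x \<in> S \<Longrightarrow> f x = g x) \<Longrightarrow> smooth_on g S"
  unfolding smooth_on_def by fastforce

lemma smooth_on_bounded_linear:
  assumes L: "bounded_linear L" and f: "smooth_on f S"
  shows "smooth_on (\<lambda>x. L (f x)) S"
  unfolding smooth_on_def
proof
  fix x assume x: "x \<in> S"
  obtain U h where U: "open U" "x \<in> U" "\<forall>k. Ck_on k h U" "\<forall>y\<in>U \<inter> S. h y = f y"
    using smooth_onD[OF f x] by (elim exE conjE)
  then show "\<exists>U h. open U \<and> x \<in> U \<and> (\<forall>k. Ck_on k h U) \<and> (\<forall>y\<in>U \<inter> S. h y = L (f y))"
    by (intro exI[of _ U] exI[of _ "\<lambda>x. L (h x)"]) (auto intro: Ck_on_bounded_linear[OF L])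
qed

lemma smooth_on_bilinear:
  assumes B: "bounded_bilinear B" and f: "smooth_on f S" and g: "smooth_on g S"
  shows "smooth_on (\<lambda>x. B (f x) (g x)) S"
  unfolding smooth_on_def
proof
  fix x assume x: "x \<in> S"
  obtain U h where U: "open U" "x \<in> U" "\<forall>k. Ck_on k h U" "\<forall>y\<in>U \<inter> S. h y = f y"
    using smooth_onD[OF f x] by (elim exE conjE)
  obtain V l where V: "open V" "x \<in> V" "\<forall>k. Ck_on k l V" "\<forall>y\<in>V \<inter> S. l y = g y"
    using smooth_onD[OF g x] by (elim exE conjE)
  show "\<exists>U h. open U \<and> x \<in> U \<and> (\<forall>k. Ck_on k h U) \<and> (\<forall>y\<in>U \<inter> S. h y = B (f y) (g y))"
    using U V
    by (intro exI[of _ "U \<inter> V"] exI[of _ "\<lambda>x. B (h x) (l x)"])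
      (auto intro!: Ck_on_bilinear[OF B] open_Int intro: Ck_on_subset[of _ _ U] Ck_on_subset[of _ _ V])
qed

lemma smooth_on_add:
  assumes f: "smooth_on f S" and g: "smooth_on g S"
  shows "smooth_on (\<lambda>x. f x + g x) S"
  unfolding smooth_on_def
proof
  fix x assume x: "x \<in> S"
  obtain U h where U: "open U" "x \<in> U" "\<forall>k. Ck_on k h U" "\<forall>y\<in>U \<inter> S. h y = f y"
    using smooth_onD[OF f x] by (elim exE conjE)
  obtain V l where V: "open V" "x \<in> V" "\<forall>k. Ck_on k l V" "\<forall>y\<in>V \<inter> S. l y = g y"
    using smooth_onD[OF g x] by (elim exE conjE)
  show "\<exists>U h. open U \<and> x \<in> U \<and> (\<forall>k. Ck_on k h U) \<and> (\<forall>y\<in>U \<inter> S. h y = f y + g y)"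
    using U V
    by (intro exI[of _ "U \<inter> V"] exI[of _ "\<lambda>x. h x + l x"])
      (auto intro!: Ck_on_add open_Int intro: Ck_on_subset[of _ _ U] Ck_on_subset[of _ _ V])
qed

lemma smooth_on_sum: "(\<And>i. i \<in> I \<Longrightarrow> smooth_on (f i) S) \<Longrightarrow> smooth_on (\<lambda>x. \<Sum>i\<in>I. f i x) S"
  by (induction I rule: infinite_finite_induct) (auto intro: smooth_on_const smooth_on_add)

lemma smooth_on_prod:
  fixes f :: "'i \<Rightarrow> 'v::euclidean_space \<Rightarrow> real"
  shows "(\<And>i. i \<in> I \<Longrightarrow> smooth_on (f i) S) \<Longrightarrow> smooth_on (\<lambda>x. \<Prod>i\<in>I. f i x) S"
  by (induction I rule: infinite_finite_induct) (auto intro: smooth_on_const smooth_on_bilinear[OF bounded_bilinear_mult])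

lemma smooth_on_powr:
  fixes f :: "'v::euclidean_space \<Rightarrow> real"
  assumes f: "smooth_on f S" and pos: "\<And>x. x \<in> S \<Longrightarrow> f x > 0"
  shows "smooth_on (\<lambda>x. f x powr a) S"
  unfolding smooth_on_def
proof
  fix x assume x: "x \<in> S"
  obtain U h where U: "open U" "x \<in> U" "\<forall>k. Ck_on k h U" "\<forall>y\<in>U \<inter> S. h y = f y"
    using smooth_onD[OF f x] by (elim exE conjE)
  define V where "V = U \<inter> h -` {0<..}"
  have "continuous_on U h" using spec[OF U(3), of 0] by simp
  then have V: "open V" unfolding V_def using U(1) by (intro continuous_open_preimage) auto
  have "x \<in> V" using x U(2,4) pos unfolding V_def by auto
  moreover have "Ck_on k (\<lambda>x. h x powr a) V" for k
    using Ck_on_subset[OF spec[OF U(3)]] by (intro Ck_on_powr[OF V]) (auto simp: V_def)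
  ultimately show "\<exists>U h. open U \<and> x \<in> U \<and> (\<forall>k. Ck_on k h U) \<and> (\<forall>y\<in>U \<inter> S. h y = f y powr a)"
    using V U(4) by (intro exI[of _ V] exI[of _ "\<lambda>x. h x powr a"]) (auto simp: V_def)
qed

lemma smooth_tangent_extension: "smooth_vector_field (tangent_extension v)"
proof -
  have "smooth_on (\<lambda>x. v + - 1 *\<^sub>R ((v \<bullet> x) *\<^sub>R x)) unit_sphere" for v :: 'a
    by (intro smooth_on_add smooth_on_const smooth_on_bounded_linear[OF bounded_linear_scaleR_right]
        smooth_on_bilinear[OF bounded_bilinear_scaleR] smooth_on_bounded_linear[OF bounded_linear_inner_right] smooth_on_id)
  then have "smooth_on (tangent_extension v) unit_sphere"
    by (rule smooth_on_cong) (simp add: tangent_extension_def)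
  then show ?thesis
    unfolding smooth_vector_field_def
    by (simp add: tangent_extension_def sphere_tangent_def inner_diff_left dot_square_norm)
qed

text \<open>Differentiability along the sphere, in the form in which \<open>sphere_deriv\<close> uses it: the radial
  extension is differentiable. It makes all derivatives below honest derivatives in the ambient space.\<close>

definition sphere_differentiable ::
    "('v::euclidean_space \<Rightarrow> 'b::real_normed_vector) \<Rightarrow> 'v \<Rightarrow> bool" where
  "sphere_differentiable f x \<longleftrightarrow> (\<lambda>y. f (y /\<^sub>R norm y)) differentiable (at x)"

lemma sphere_deriv_eqI:
  "((\<lambda>y. f (y /\<^sub>R norm y)) has_derivative D) (at x) \<Longrightarrow> sphere_deriv f x = D"
  unfolding sphere_deriv_def using frechet_derivative_at by fastforce

lemma sphere_differentiableD:
  "sphere_differentiable f x \<Longrightarrow> ((\<lambda>y. f (y /\<^sub>R norm y)) has_derivative sphere_deriv f x) (at x)"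
  unfolding sphere_differentiable_def sphere_deriv_def using frechet_derivative_works by fastforce

lemma sphere_differentiableI:
  "((\<lambda>y. f (y /\<^sub>R norm y)) has_derivative D) (at x) \<Longrightarrow> sphere_differentiable f x"
  unfolding sphere_differentiable_def differentiable_def by blast

lemma has_derivative_radial:
  fixes x :: "'v::euclidean_space"
  assumes "norm x = 1"
  shows "((\<lambda>y. y /\<^sub>R norm y) has_derivative (\<lambda>v. v - (v \<bullet> x) *\<^sub>R x)) (at x)"
proof -
  have x: "x \<noteq> 0" using assms by auto
  show ?thesis
    by (rule derivative_eq_intros has_derivative_norm refl x | simp add: assms x sgn_div_norm inner_commute)+
qed

lemma smooth_on_sphere_differentiable:
  fixes f :: "'v::euclidean_space \<Rightarrow> 'b::real_normed_vector"
  assumes f: "smooth_on f unit_sphere" and x: "norm x = 1"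
  shows "sphere_differentiable f x"
proof -
  have "x \<in> unit_sphere" using x by simp
  then obtain U h where U: "open U" "x \<in> U" "\<forall>k. Ck_on k h U" "\<forall>y\<in>U \<inter> unit_sphere. h y = f y"
    using f unfolding smooth_on_def by blast
  have "Ck_on (Suc 0) h U" using U(3) by blast
  then have "h differentiable (at x)" using U(2) by simp
  then obtain D where D: "(h has_derivative D) (at (x /\<^sub>R norm x))"
    using x unfolding differentiable_def by auto
  have comp: "((\<lambda>y. h (y /\<^sub>R norm y)) has_derivative (\<lambda>v. D (v - (v \<bullet> x) *\<^sub>R x))) (at x)"
    using diff_chain_at[OF has_derivative_radial[OF x] D] by (simp add: o_def)
  have "((\<lambda>y. y /\<^sub>R norm y) \<longlongrightarrow> x /\<^sub>R norm x) (at x)"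
    using x by (intro tendsto_intros) auto
  then have "\<forall>\<^sub>F y in at x. y /\<^sub>R norm y \<in> U"
    using U(1,2) x by (intro topological_tendstoD) auto
  moreover have "\<forall>\<^sub>F y in at x. y \<noteq> (0::'v)"
    using x by (intro eventually_neq_at_within) 
  ultimately have "\<forall>\<^sub>F y in at x. h (y /\<^sub>R norm y) = f (y /\<^sub>R norm y)"
    by eventually_elim (use U(4) in auto)
  then have "((\<lambda>y. f (y /\<^sub>R norm y)) has_derivative (\<lambda>v. D (v - (v \<bullet> x) *\<^sub>R x))) (at x)"
    using comp U(2,4) x by (intro has_derivative_transform_eventually[OF comp]) auto
  then show ?thesis by (rule sphere_differentiableI)
qed

text \<open>The product rule for a varying bilinear form evaluated on varying vectors, assuming only that its
  values on fixed vectors are differentiable.\<close>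

lemma has_derivative_bilinear_family:
  fixes H :: "'w::real_normed_vector \<Rightarrow> 'v::euclidean_space \<Rightarrow> 'v \<Rightarrow> real"
  assumes bil: "\<And>t. bilinear (H t)"
    and H: "\<And>u v. ((\<lambda>t. H t u v) has_derivative DH u v) (at t)"
    and Y: "(Y has_derivative Y') (at t)" and Z: "(Z has_derivative Z') (at t)"
  shows "((\<lambda>t. H t (Y t) (Z t)) has_derivative
    (\<lambda>s. DH (Y t) (Z t) s + H t (Y' s) (Z t) + H t (Y t) (Z' s))) (at t)"
proof -
  have expand: "H t u v = (\<Sum>i\<in>Basis. \<Sum>j\<in>Basis. (u \<bullet> i) * (v \<bullet> j) * H t i j)" for t u v
    using bilinear_sum_expand[OF bil, of t "\<lambda>i. u \<bullet> i" "\<lambda>i. i" Basis "\<lambda>i. v \<bullet> i" "\<lambda>i. i" Basis]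
    by (simp add: euclidean_representation)
  have "((\<lambda>t. \<Sum>i\<in>Basis. \<Sum>j\<in>Basis. (u \<bullet> i) * (v \<bullet> j) * H t i j) has_derivative
     (\<lambda>s. \<Sum>i\<in>Basis. \<Sum>j\<in>Basis. (u \<bullet> i) * (v \<bullet> j) * DH i j s)) (at t)" for u v
    by (intro has_derivative_sum has_derivative_mult_right H)
  then have "((\<lambda>t. H t u v) has_derivative
     (\<lambda>s. \<Sum>i\<in>Basis. \<Sum>j\<in>Basis. (u \<bullet> i) * (v \<bullet> j) * DH i j s)) (at t)" for u v
    by (simp flip: expand)
  then have DH: "DH u v = (\<lambda>s. \<Sum>i\<in>Basis. \<Sum>j\<in>Basis. (u \<bullet> i) * (v \<bullet> j) * DH i j s)" for u v
    using H has_derivative_unique by blast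
  have "((\<lambda>t. \<Sum>i\<in>Basis. \<Sum>j\<in>Basis. (Y t \<bullet> i) * (Z t \<bullet> j) * H t i j) has_derivative
     (\<lambda>s. \<Sum>i\<in>Basis. \<Sum>j\<in>Basis. (Y t \<bullet> i) * (Z t \<bullet> j) * DH i j s
        + ((Y t \<bullet> i) * (Z' s \<bullet> j) + (Y' s \<bullet> i) * (Z t \<bullet> j)) * H t i j)) (at t)"
    by (intro has_derivative_sum has_derivative_mult H has_derivative_inner_left Y Z)
  then have "((\<lambda>t. H t (Y t) (Z t)) has_derivative
     (\<lambda>s. \<Sum>i\<in>Basis. \<Sum>j\<in>Basis. (Y t \<bullet> i) * (Z t \<bullet> j) * DH i j s
        + ((Y t \<bullet> i) * (Z' s \<bullet> j) + (Y' s \<bullet> i) * (Z t \<bullet> j)) * H t i j)) (at t)"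
    by (simp flip: expand)
  moreover have "(\<Sum>i\<in>Basis. \<Sum>j\<in>Basis. (Y t \<bullet> i) * (Z t \<bullet> j) * DH i j s
        + ((Y t \<bullet> i) * (Z' s \<bullet> j) + (Y' s \<bullet> i) * (Z t \<bullet> j)) * H t i j)
      = DH (Y t) (Z t) s + H t (Y' s) (Z t) + H t (Y t) (Z' s)" for s
    unfolding DH[of "Y t" "Z t"] expand[of t "Y' s"] expand[of t "Y t"]
    by (simp add: sum.distrib algebra_simps)
  ultimately show ?thesis by simp
qed

section \<open>The Levi-Civita connection of a metric on the sphere\<close>

text \<open>A metric is only meaningful on tangent vectors. Composing it with the tangential projections gives
  bilinear forms on the whole ambient space, degenerate in the direction of \<open>x\<close>, whose values on constant
  vectors can be differentiated.\<close>

definition metric_ext :: "'v::euclidean_space metric \<Rightarrow> 'v metric" where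
  "metric_ext g x u v = g x (tangent_extension u x) (tangent_extension v x)"

lemma tangent_extension_linear:
  "tangent_extension (u + v) x = tangent_extension u x + tangent_extension v x"
  "tangent_extension (c *\<^sub>R u) x = c *\<^sub>R tangent_extension u x"
  by (auto simp: tangent_extension_def algebra_simps inner_add_left)

lemma tangent_extension_tangent: "norm x = 1 \<Longrightarrow> tangent_extension v x \<in> sphere_tangent x"
  by (simp add: tangent_extension_def sphere_tangent_def inner_diff_left dot_square_norm)

lemma tangent_extension_id: "v \<in> sphere_tangent x \<Longrightarrow> tangent_extension v x = v"
  by (simp add: tangent_extension_def sphere_tangent_def)

lemma tangent_extension_self: "norm x = 1 \<Longrightarrow> tangent_extension x x = 0"
  by (simp add: tangent_extension_def dot_square_norm)

lemma metric_ext_eq: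
  "u \<in> sphere_tangent x \<Longrightarrow> v \<in> sphere_tangent x \<Longrightarrow> metric_ext g x u v = g x u v"
  by (simp add: metric_ext_def tangent_extension_id)

lemma riemannian_zero: "g \<in> riemannian_metrics \<Longrightarrow> norm x \<noteq> 1 \<Longrightarrow> g x u v = 0"
  unfolding riemannian_metrics_def by simp

lemma riemannian_zero_not_tangent: "g \<in> riemannian_metrics \<Longrightarrow> u \<notin> sphere_tangent x \<or> v \<notin> sphere_tangent x \<Longrightarrow> g x u v = 0"
  unfolding riemannian_metrics_def by blast

lemma metric_ext_bilinear:
  assumes g: "g \<in> riemannian_metrics"
  shows "bilinear (metric_ext g x)"
proof (cases "norm x = 1")
  case False
  then show ?thesis using riemannian_zero[OF g] by (simp add: metric_ext_def bilinear_def linear_zero)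
next
  case True
  then have x: "x \<in> unit_sphere" by simp
  note t = tangent_extension_tangent[OF True]
  have "g x (u + v) w = g x u w + g x v w" "g x (c *\<^sub>R u) w = c * g x u w" "g x u v = g x v u"
    if "u \<in> sphere_tangent x" "v \<in> sphere_tangent x" "w \<in> sphere_tangent x" for u v w c
    using g x that unfolding riemannian_metrics_def by blast+
  then have r: "g x (tangent_extension u x + tangent_extension v x) (tangent_extension w x)
        = g x (tangent_extension u x) (tangent_extension w x) + g x (tangent_extension v x) (tangent_extension w x)"
      "g x (tangent_extension w x) (tangent_extension u x + tangent_extension v x)
        = g x (tangent_extension w x) (tangent_extension u x) + g x (tangent_extension w x) (tangent_extension v x)"
      "g x (c *\<^sub>R tangent_extension u x) (tangent_extension w x) = c * g x (tangent_extension u x) (tangent_extension w x)"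
      "g x (tangent_extension w x) (c *\<^sub>R tangent_extension u x) = c * g x (tangent_extension w x) (tangent_extension u x)"
    for u v w c
    using t by (metis tangent_extension_linear)+
  show ?thesis unfolding bilinear_def linear_iff metric_ext_def tangent_extension_linear
    by (auto simp: r)
qed

lemma metric_ext_sym:
  assumes g: "g \<in> riemannian_metrics"
  shows "metric_ext g x u v = metric_ext g x v u"
proof (cases "norm x = 1")
  case False
  then show ?thesis using riemannian_zero[OF g] by (simp add: metric_ext_def)
next
  case True
  then have "x \<in> unit_sphere" by simp
  then show ?thesis
    using g tangent_extension_tangent[OF True] unfolding riemannian_metrics_def metric_ext_def by blast
qed

lemma metric_ext_self: 
  assumes g: "g \<in> riemannian_metrics" and "norm x = 1"
  shows "metric_ext g x x v = 0" "metric_ext g x v x = 0"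
proof -
  have "metric_ext g x x v = metric_ext g x 0 v"
    using assms by (simp add: metric_ext_def tangent_extension_self) (simp add: tangent_extension_def)
  then show "metric_ext g x x v = 0" using bilinear_lzero[OF metric_ext_bilinear[OF g]] by simp
  then show "metric_ext g x v x = 0" using metric_ext_sym[OF g] by simp
qed

lemma metric_ext_pos:
  assumes g: "g \<in> riemannian_metrics" and "norm x = 1" "v \<in> sphere_tangent x" "v \<noteq> 0"
  shows "metric_ext g x v v > 0"
  using assms unfolding riemannian_metrics_def by (simp add: metric_ext_eq)

text \<open>Covariant derivative of the metric with respect to the round connection, when \<open>X\<close>, \<open>u\<close>, \<open>v\<close> are
  tangent at \<open>x\<close>.\<close>

definition metric_deriv :: "'v::euclidean_space metric \<Rightarrow> 'v \<Rightarrow> 'v \<Rightarrow> 'v \<Rightarrow> 'v \<Rightarrow> real" where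
  "metric_deriv g x X u v = sphere_deriv (\<lambda>y. metric_ext g y u v) x X"

lemma metric_ext_has_derivative:
  assumes g: "g \<in> riemannian_metrics" and x: "norm x = 1"
  shows "((\<lambda>y. metric_ext g (y /\<^sub>R norm y) u v) has_derivative (\<lambda>X. metric_deriv g x X u v)) (at x)"
proof -
  have "smooth_on (\<lambda>x. metric_ext g x u v) unit_sphere"
    using g smooth_tangent_extension unfolding riemannian_metrics_def metric_ext_def by blast
  then have "sphere_differentiable (\<lambda>x. metric_ext g x u v) x"
    using x by (rule smooth_on_sphere_differentiable)
  then show ?thesis unfolding metric_deriv_def by (rule sphere_differentiableD)
qed

lemma metric_deriv_eqI:
  assumes "((\<lambda>y. metric_ext g (y /\<^sub>R norm y) u v) has_derivative D) (at x)"
  shows "metric_deriv g x X u v = D X"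
  unfolding metric_deriv_def using sphere_deriv_eqI[OF assms] by simp

lemma metric_deriv_linear:
  assumes g: "g \<in> riemannian_metrics" and x: "norm x = 1"
  shows "linear (\<lambda>X. metric_deriv g x X u v)"
  using metric_ext_has_derivative[OF assms] has_derivative_linear by blast

lemma metric_deriv_sym:
  assumes g: "g \<in> riemannian_metrics"
  shows "metric_deriv g x X u v = metric_deriv g x X v u"
  unfolding metric_deriv_def metric_ext_sym[OF g, of _ u v] ..

lemma metric_deriv_bilinear:
  assumes g: "g \<in> riemannian_metrics" and x: "norm x = 1"
  shows "bilinear (metric_deriv g x X)"
proof -
  note b = metric_ext_bilinear[OF g] and d = metric_ext_has_derivative[OF assms]
  have l: "linear (\<lambda>u. metric_deriv g x X u v)" for v
  proof (rule linearI)
    fix u w c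
    show "metric_deriv g x X (u + w) v = metric_deriv g x X u v + metric_deriv g x X w v"
      using has_derivative_add[OF d[of u v] d[of w v]]
      by (intro metric_deriv_eqI) (simp add: bilinear_ladd[OF b])
    show "metric_deriv g x X (c *\<^sub>R u) v = c *\<^sub>R metric_deriv g x X u v"
      using has_derivative_mult_right[OF d[of u v], of c]
      by (intro metric_deriv_eqI) (simp add: bilinear_lmul[OF b])
  qed
  moreover have "(\<lambda>u. metric_deriv g x X u v) = metric_deriv g x X v" for v
    by (rule ext) (rule metric_deriv_sym[OF g])
  ultimately show ?thesis unfolding bilinear_def by simp
qed

lemma metric_product_rule:
  assumes g: "g \<in> riemannian_metrics" and x: "norm x = 1"
    and Y: "smooth_vector_field Y" and Z: "smooth_vector_field Z"
  shows "sphere_deriv (\<lambda>y. g y (Y y) (Z y)) x X = metric_deriv g x X (Y x) (Z x)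
    + metric_ext g x (sphere_deriv Y x X) (Z x) + metric_ext g x (Y x) (sphere_deriv Z x X)"
proof -
  \<comment> \<open>The radial extension takes the value of the fields at \<open>0\<close> when its argument is \<open>0\<close>; there all metrics vanish by convention.\<close>
  have eq: "g y (Y y) (Z y) = metric_ext g y (Y y) (Z y)" if "y = 0 \<or> norm y = 1" for y
  proof (cases "y = 0")
    case True
    then show ?thesis using riemannian_zero[OF g] by (simp add: metric_ext_def)
  next
    case False
    then have "y \<in> unit_sphere" using that by simp
    then show ?thesis using Y Z by (simp add: smooth_vector_field_def metric_ext_eq)
  qed
  have "((\<lambda>y. Y (y /\<^sub>R norm y)) has_derivative sphere_deriv Y x) (at x)"
    "((\<lambda>y. Z (y /\<^sub>R norm y)) has_derivative sphere_deriv Z x) (at x)"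
    using Y Z x unfolding smooth_vector_field_def
    by (auto intro!: sphere_differentiableD smooth_on_sphere_differentiable)
  from has_derivative_bilinear_family[of "\<lambda>y. metric_ext g (y /\<^sub>R norm y)",
      OF metric_ext_bilinear[OF g] metric_ext_has_derivative[OF g x] this]
  have "((\<lambda>y. metric_ext g (y /\<^sub>R norm y) (Y (y /\<^sub>R norm y)) (Z (y /\<^sub>R norm y))) has_derivative
     (\<lambda>X. metric_deriv g x X (Y x) (Z x) + metric_ext g x (sphere_deriv Y x X) (Z x)
        + metric_ext g x (Y x) (sphere_deriv Z x X))) (at x)"
    using x by simp
  moreover have "(\<lambda>y. metric_ext g (y /\<^sub>R norm y) (Y (y /\<^sub>R norm y)) (Z (y /\<^sub>R norm y)))
     = (\<lambda>y. g (y /\<^sub>R norm y) (Y (y /\<^sub>R norm y)) (Z (y /\<^sub>R norm y)))"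
  proof (rule ext, rule eq[symmetric])
    show "y /\<^sub>R norm y = 0 \<or> norm (y /\<^sub>R norm y) = 1" for y :: 'a by (cases "y = 0") auto
  qed
  ultimately have "((\<lambda>y. g (y /\<^sub>R norm y) (Y (y /\<^sub>R norm y)) (Z (y /\<^sub>R norm y))) has_derivative
     (\<lambda>X. metric_deriv g x X (Y x) (Z x) + metric_ext g x (sphere_deriv Y x X) (Z x)
        + metric_ext g x (Y x) (sphere_deriv Z x X))) (at x)"
    by simp
  from sphere_deriv_eqI[of "\<lambda>y. g y (Y y) (Z y)", OF this] show ?thesis by simp
qed

lemma sphere_deriv_field_normal_part:
  assumes x: "norm x = 1" and Y: "smooth_vector_field Y" and X: "X \<in> sphere_tangent x"
  shows "sphere_deriv Y x X \<bullet> x = - (Y x \<bullet> X)"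
proof -
  have "((\<lambda>y. Y (y /\<^sub>R norm y)) has_derivative sphere_deriv Y x) (at x)"
    using Y x unfolding smooth_vector_field_def
    by (auto intro!: sphere_differentiableD smooth_on_sphere_differentiable)
  from has_derivative_inner[OF this has_derivative_radial[OF x]]
  have "((\<lambda>y. Y (y /\<^sub>R norm y) \<bullet> (y /\<^sub>R norm y)) has_derivative
      (\<lambda>h. Y x \<bullet> (h - (h \<bullet> x) *\<^sub>R x) + sphere_deriv Y x h \<bullet> x)) (at x)"
    using x by simp
  moreover have "(\<lambda>y. Y (y /\<^sub>R norm y) \<bullet> (y /\<^sub>R norm y)) = (\<lambda>y. 0)"
  proof
    fix y :: 'a
    show "Y (y /\<^sub>R norm y) \<bullet> (y /\<^sub>R norm y) = 0"
    proof (cases "y = 0")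
      case False
      then have "y /\<^sub>R norm y \<in> unit_sphere" by simp
      then show ?thesis using Y unfolding smooth_vector_field_def sphere_tangent_def by blast
    qed simp
  qed
  ultimately have "((\<lambda>y. 0) has_derivative (\<lambda>h. Y x \<bullet> (h - (h \<bullet> x) *\<^sub>R x) + sphere_deriv Y x h \<bullet> x)) (at x)"
    by simp
  from fun_cong[OF has_derivative_unique[OF this has_derivative_const], of X] show ?thesis using X by (simp add: sphere_tangent_def)
qed

text \<open>Differentiating \<open>Y \<bullet> x = 0\<close> along \<open>X\<close> shows that the normal part of \<open>D\<^sub>X Y\<close> is symmetric in \<open>X\<close> and
  \<open>Y\<close>. The tangency matters here because a metric is set to zero on vectors that are not tangent.\<close>

lemma lie_bracket_tangent:
  assumes x: "norm x = 1" and X: "smooth_vector_field X" and Y: "smooth_vector_field Y"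
  shows "lie_bracket X Y x \<in> sphere_tangent x"
proof -
  have "X x \<in> sphere_tangent x" "Y x \<in> sphere_tangent x"
    using X Y x unfolding smooth_vector_field_def by auto
  then show ?thesis
    using sphere_deriv_field_normal_part[OF x X, of "Y x"] sphere_deriv_field_normal_part[OF x Y, of "X x"]
    by (simp add: lie_bracket_def sphere_tangent_def inner_diff_left inner_diff_right inner_commute)
qed

lemma sphere_deriv_tangent_extension:
  assumes x: "norm x = 1" and v: "v \<in> sphere_tangent x"
  shows "sphere_deriv (tangent_extension v) x v = - (v \<bullet> v) *\<^sub>R x"
proof -
  have vx: "v \<bullet> x = 0" using v by (simp add: sphere_tangent_def)
  have "((\<lambda>y. v - (v \<bullet> (y /\<^sub>R norm y)) *\<^sub>R (y /\<^sub>R norm y)) has_derivative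
     (\<lambda>h. 0 - ((v \<bullet> (x /\<^sub>R norm x)) *\<^sub>R (h - (h \<bullet> x) *\<^sub>R x) + (v \<bullet> (h - (h \<bullet> x) *\<^sub>R x)) *\<^sub>R (x /\<^sub>R norm x)))) (at x)"
    by (intro has_derivative_diff has_derivative_scaleR has_derivative_inner_right
        has_derivative_const has_derivative_radial[OF x])
  from sphere_deriv_eqI[of "tangent_extension v", unfolded tangent_extension_def[abs_def], OF this]
  show ?thesis using x vx by (simp add: tangent_extension_def[abs_def])
qed

text \<open>In the Koszul formula all derivatives of the test field cancel, so its right hand side is a
  linear function of the value of that field at \<open>x\<close> and the definite description is met by a unique
  vector. The derivative of the projected field \<open>v\<close> along \<open>v\<close> is normal to the sphere and contributes nothing.\<close>

lemma levi_civita_tangent_extension: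
  fixes g :: "'v::euclidean_space metric"
  assumes g: "g \<in> riemannian_metrics" and x: "norm x = 1"
    and v: "v \<in> sphere_tangent x" and z: "z \<in> sphere_tangent x"
  shows "g x (levi_civita g (tangent_extension v) (tangent_extension v) x) z
    = metric_deriv g x v v z - metric_deriv g x z v v / 2"
proof -
  let ?X = "tangent_extension v" and ?l = "\<lambda>z. metric_deriv g x v v z - metric_deriv g x z v v / 2"
  note b = metric_ext_bilinear[OF g] and s = metric_ext_sym[OF g]
  have Xx: "?X x = v" using v by (rule tangent_extension_id)
  have koszul: "sphere_deriv (\<lambda>y. g y (?X y) (Z y)) x (?X x)
          + sphere_deriv (\<lambda>y. g y (Z y) (?X y)) x (?X x)
          - sphere_deriv (\<lambda>y. g y (?X y) (?X y)) x (Z x)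
          + g x (lie_bracket ?X ?X x) (Z x)
          - g x (lie_bracket ?X Z x) (?X x)
          - g x (lie_bracket ?X Z x) (?X x) = 2 * ?l (Z x)" if Z: "smooth_vector_field Z" for Z :: "'v \<Rightarrow> 'v"
  proof -
    have Zx: "Z x \<in> sphere_tangent x" using Z x unfolding smooth_vector_field_def by auto
    have lb: "g x (lie_bracket ?X Z x) v = metric_ext g x (lie_bracket ?X Z x) v"
      using lie_bracket_tangent[OF x smooth_tangent_extension Z] v by (simp add: metric_ext_eq)
    have XX: "g x (lie_bracket ?X ?X x) (Z x) = 0"
      using bilinear_lzero[OF b] Zx metric_ext_eq[of 0 x "Z x" g]
      by (simp add: lie_bracket_def) (simp add: sphere_tangent_def)
    have DX: "metric_ext g x (sphere_deriv ?X x v) u = 0" for u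
      using metric_ext_self[OF g x]
      by (simp add: sphere_deriv_tangent_extension[OF x v] bilinear_lneg[OF b] bilinear_lmul[OF b])
    show ?thesis
      unfolding metric_product_rule[OF g x smooth_tangent_extension Z]
        metric_product_rule[OF g x Z smooth_tangent_extension]
        metric_product_rule[OF g x smooth_tangent_extension smooth_tangent_extension] Xx XX lb
      using DX s[of x v] s[of x "Z x"] metric_deriv_sym[OF g, of x v "Z x" v]
      by (simp add: lie_bracket_def Xx bilinear_lsub[OF b])
  qed
  have l: "linear ?l"
    using metric_deriv_bilinear[OF g x] metric_deriv_linear[OF g x] unfolding bilinear_def
    by (intro linear_compose_sub) (auto simp: linear_iff add_divide_distrib)
  have ex1: "\<exists>!w. w \<in> sphere_tangent x \<and> (\<forall>z\<in>sphere_tangent x. metric_ext g x w z = ?l z)"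
    using metric_ext_pos[OF g x] by (intro form_riesz[OF b s subspace_sphere_tangent _ l]) auto
  \<comment> \<open>Testing against all smooth fields is testing against all tangent vectors, since each of these extends to a field.\<close>
  have iff: "(w \<in> sphere_tangent x \<and> (\<forall>Z :: 'v \<Rightarrow> 'v. smooth_vector_field Z \<longrightarrow>
        2 * g x w (Z x) =
            sphere_deriv (\<lambda>y. g y (?X y) (Z y)) x (?X x)
          + sphere_deriv (\<lambda>y. g y (Z y) (?X y)) x (?X x)
          - sphere_deriv (\<lambda>y. g y (?X y) (?X y)) x (Z x)
          + g x (lie_bracket ?X ?X x) (Z x)
          - g x (lie_bracket ?X Z x) (?X x)
          - g x (lie_bracket ?X Z x) (?X x)))
    \<longleftrightarrow> (w \<in> sphere_tangent x \<and> (\<forall>z\<in>sphere_tangent x. metric_ext g x w z = ?l z))" for w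
  proof (rule conj_cong[OF refl])
    assume w: "w \<in> sphere_tangent x"
    show "(\<forall>Z :: 'v \<Rightarrow> 'v. smooth_vector_field Z \<longrightarrow>
        2 * g x w (Z x) =
            sphere_deriv (\<lambda>y. g y (?X y) (Z y)) x (?X x)
          + sphere_deriv (\<lambda>y. g y (Z y) (?X y)) x (?X x)
          - sphere_deriv (\<lambda>y. g y (?X y) (?X y)) x (Z x)
          + g x (lie_bracket ?X ?X x) (Z x)
          - g x (lie_bracket ?X Z x) (?X x)
          - g x (lie_bracket ?X Z x) (?X x))
      \<longleftrightarrow> (\<forall>z\<in>sphere_tangent x. metric_ext g x w z = ?l z)" (is "?A \<longleftrightarrow> ?B")
    proof
      assume A: ?A
      show ?B
      proof
        fix z assume z: "z \<in> sphere_tangent x"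
        have "2 * g x w (tangent_extension z x) = 2 * ?l (tangent_extension z x)"
          using A koszul[OF smooth_tangent_extension, of z] smooth_tangent_extension[of z] by presburger
        then show "metric_ext g x w z = ?l z" using z w by (simp add: tangent_extension_id metric_ext_eq)
      qed
    next
      assume B: ?B
      show ?A
      proof (intro allI impI)
        fix Z :: "'v \<Rightarrow> 'v" assume Z: "smooth_vector_field Z"
        then have "Z x \<in> sphere_tangent x" using x unfolding smooth_vector_field_def by auto
        then have "2 * g x w (Z x) = 2 * ?l (Z x)" using B w by (simp add: metric_ext_eq)
        then show "2 * g x w (Z x) =
            sphere_deriv (\<lambda>y. g y (?X y) (Z y)) x (?X x)
          + sphere_deriv (\<lambda>y. g y (Z y) (?X y)) x (?X x)
          - sphere_deriv (\<lambda>y. g y (?X y) (?X y)) x (Z x)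
          + g x (lie_bracket ?X ?X x) (Z x)
          - g x (lie_bracket ?X Z x) (?X x)
          - g x (lie_bracket ?X Z x) (?X x)" using koszul[OF Z] by simp
      qed
    qed
  qed
  have "levi_civita g ?X ?X x = (THE w. w \<in> sphere_tangent x \<and> (\<forall>z\<in>sphere_tangent x. metric_ext g x w z = ?l z))"
    unfolding levi_civita_def iff ..
  with theI'[OF ex1] have "levi_civita g ?X ?X x \<in> sphere_tangent x"
    "metric_ext g x (levi_civita g ?X ?X x) z = ?l z" using z by auto
  then show ?thesis using z by (simp add: metric_ext_eq)
qed

lemma second_fundamental_form_eq:
  assumes "g \<in> riemannian_metrics" and "norm p = 1" and "v \<in> sphere_tangent p" and "N \<in> sphere_tangent p"
  shows "second_fundamental_form g p N v v = metric_deriv g p v v N - metric_deriv g p N v v / 2"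
  unfolding second_fundamental_form_def by (rule levi_civita_tangent_extension[OF assms])

section \<open>Mean curvature of equators\<close>

definition tangent_basis :: "'v::euclidean_space metric \<Rightarrow> 'v \<Rightarrow> 'v set \<Rightarrow> bool" where
  "tangent_basis g p E \<longleftrightarrow> form_orthonormal (metric_ext g p) E \<and> span E = sphere_tangent p"

lemma tangent_basis_exists:
  assumes g: "g \<in> riemannian_metrics" and p: "norm p = 1"
  shows "\<exists>E. tangent_basis g p E"
  using form_orthonormal_basis_exists[OF metric_ext_bilinear[OF g] metric_ext_sym[OF g]
      subspace_sphere_tangent metric_ext_pos[OF g p], of p]
  unfolding tangent_basis_def by blast

lemma tangent_basis_card:
  fixes p :: "'v::euclidean_space"
  assumes g: "g \<in> riemannian_metrics" and p: "norm p = 1" and E: "tangent_basis g p E"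
  shows "finite E" "real (card E) + 1 = real DIM('v)"
proof -
  have b: "form_orthonormal (metric_ext g p) E" and s: "span E = sphere_tangent p"
    using E by (auto simp: tangent_basis_def)
  show "finite E" by (rule form_orthonormal_finite(1)[OF metric_ext_bilinear[OF g] b])
  have "p \<noteq> 0" using p by auto
  have "sphere_tangent p = {x. p \<bullet> x = 0}" by (auto simp: sphere_tangent_def inner_commute)
  then have "dim (span E) = DIM('v) - 1" using dim_hyperplane[OF \<open>p \<noteq> 0\<close>] s by simp
  then have "card E = DIM('v) - 1" using form_orthonormal_finite(2)[OF metric_ext_bilinear[OF g] b] by simp
  moreover have "DIM('v) \<ge> 1" using DIM_positive by (simp add: Suc_le_eq)
  ultimately show "real (card E) + 1 = real DIM('v)" by (simp add: of_nat_diff)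
qed

definition metric_trace :: "'v::euclidean_space metric \<Rightarrow> 'v \<Rightarrow> 'v set \<Rightarrow> 'v \<Rightarrow> real" where
  "metric_trace g p E X = (\<Sum>e\<in>E. metric_deriv g p X e e)"

definition metric_div :: "'v::euclidean_space metric \<Rightarrow> 'v \<Rightarrow> 'v set \<Rightarrow> 'v \<Rightarrow> real" where
  "metric_div g p E X = (\<Sum>e\<in>E. metric_deriv g p e e X)"

lemma metric_trace_linear:
  assumes g: "g \<in> riemannian_metrics" and p: "norm p = 1"
  shows "linear (metric_trace g p E)" "linear (metric_div g p E)"
proof -
  have "linear (\<lambda>X. \<Sum>e\<in>E. metric_deriv g p X e e)"
    by (intro linear_compose_sum ballI metric_deriv_linear[OF assms])
  then show "linear (metric_trace g p E)" by (simp add: metric_trace_def[abs_def])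
  have "linear (\<lambda>X. \<Sum>e\<in>E. metric_deriv g p e e X)"
    using metric_deriv_bilinear[OF assms] unfolding bilinear_def by (intro linear_compose_sum ballI) simp
  then show "linear (metric_div g p E)" by (simp add: metric_div_def[abs_def])
qed

text \<open>Adjoining \<open>N\<close> to an orthonormal basis of the equator gives one of the whole tangent space. So
  the sum over the equator is a full trace minus the term of \<open>N\<close>, and the full traces do not depend
  on the equator.\<close>

lemma mean_curvature_eq:
  assumes g: "g \<in> riemannian_metrics" and p: "norm p = 1" and E: "tangent_basis g p E"
    and N: "unit_normal g a p N"
  shows "mean_curvature g a p N = metric_div g p E N - metric_trace g p E N / 2 - metric_deriv g p N N N / 2"
proof -
  let ?G = "metric_ext g p"
  note bil = metric_ext_bilinear[OF g, of p] and sym = metric_ext_sym[OF g, of p]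
  have NT: "N \<in> sphere_tangent p" and NN: "?G N N = 1" and Nv: "\<And>v. v \<in> equator_tangent a p \<Longrightarrow> ?G N v = 0"
    and sub: "equator_tangent a p \<subseteq> sphere_tangent p"
    using N unfolding unit_normal_def equator_tangent_def
    by (auto simp: metric_ext_eq sphere_tangent_def)
  have sS: "subspace (equator_tangent a p)"
    by (auto simp: subspace_def equator_tangent_def inner_add_left inner_add_right)
  define B where "B = (SOME B. orthonormal_basis g a p B)"
  have eq: "orthonormal_basis g a p B \<longleftrightarrow>
     B \<subseteq> equator_tangent a p \<and> span B = equator_tangent a p \<and> form_orthonormal ?G B" for B
  proof -
    have "g p u v = ?G u v" if "B \<subseteq> equator_tangent a p" "u \<in> B" "v \<in> B" for u v
    proof -
      have "u \<in> sphere_tangent p" "v \<in> sphere_tangent p" using that sub by blast+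
      then show ?thesis by (simp add: metric_ext_eq)
    qed
    then show ?thesis unfolding orthonormal_basis_def form_orthonormal_def by auto
  qed
  have "\<exists>B. B \<subseteq> equator_tangent a p \<and> span B = equator_tangent a p \<and> form_orthonormal ?G B"
    using sub by (intro form_orthonormal_basis_exists[OF bil sym sS] metric_ext_pos[OF g p]) auto
  then have "\<exists>B. orthonormal_basis g a p B" unfolding eq .
  then have "orthonormal_basis g a p B" unfolding B_def by (rule someI_ex)
  then have B: "B \<subseteq> equator_tangent a p" "span B = equator_tangent a p" "form_orthonormal ?G B"
    by (simp_all add: eq)
  have finB: "finite B" by (rule form_orthonormal_finite(1)[OF bil B(3)])
  have NB: "?G N v = 0" "?G v N = 0" if "v \<in> B" for v using that Nv B(1) sym[of v N] by auto
  have notin: "N \<notin> B" using NN NB(1)[of N] by auto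
  have on: "form_orthonormal ?G (insert N B)"
    using B(3) NB NN notin unfolding form_orthonormal_def by auto
  have aN: "a \<bullet> N \<noteq> 0"
  proof
    assume "a \<bullet> N = 0"
    then have "N \<in> equator_tangent a p" using NT by (simp add: equator_tangent_def sphere_tangent_def)
    then show False using Nv NN by fastforce
  qed
  have "span (insert N B) = sphere_tangent p"
  proof
    show "span (insert N B) \<subseteq> sphere_tangent p"
      using B(1) sub NT by (intro span_minimal subspace_sphere_tangent) auto
    show "sphere_tangent p \<subseteq> span (insert N B)"
    proof
      fix u assume u: "u \<in> sphere_tangent p"
      define c where "c = (a \<bullet> u) / (a \<bullet> N)"
      have "u - c *\<^sub>R N \<in> equator_tangent a p"
        using u NT aN unfolding c_def
        by (simp add: equator_tangent_def sphere_tangent_def inner_diff_left inner_diff_right)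
      then have "u - c *\<^sub>R N \<in> span (insert N B)" using B(2) span_mono[of B "insert N B"] by blast
      moreover have "c *\<^sub>R N \<in> span (insert N B)" by (simp add: span_base span_scale)
      ultimately show "u \<in> span (insert N B)" using span_add by fastforce
    qed
  qed
  then have sp: "span (insert N B) = span E" and onE: "form_orthonormal ?G E"
    using E by (auto simp: tangent_basis_def)
  have "bilinear (\<lambda>u v. metric_deriv g p u v N)"
    using metric_deriv_bilinear[OF g p] metric_deriv_linear[OF g p] by (simp add: bilinear_def)
  from form_trace_independent[OF bil sym this on onE sp]
  have div: "metric_div g p E N = metric_deriv g p N N N + (\<Sum>e\<in>B. metric_deriv g p e e N)"
    using finB notin by (simp add: metric_div_def)
  from form_trace_independent[OF bil sym metric_deriv_bilinear[OF g p] on onE sp]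
  have tr: "metric_trace g p E N = metric_deriv g p N N N + (\<Sum>e\<in>B. metric_deriv g p N e e)"
    using finB notin by (simp add: metric_trace_def)
  have "mean_curvature g a p N = (\<Sum>e\<in>B. metric_deriv g p e e N - metric_deriv g p N e e / 2)"
    unfolding mean_curvature_def B_def[symmetric]
    using B(1) sub NT by (intro sum.cong refl second_fundamental_form_eq[OF g p]) auto
  also have "\<dots> = metric_div g p E N - metric_trace g p E N / 2 - metric_deriv g p N N N / 2"
    by (simp add: div tr sum_subtractf sum_divide_distrib add_divide_distrib)
  finally show ?thesis .
qed

text \<open>The equator is cut out by the hyperplane on which \<open>N\<close> is \<open>g\<close>-orthogonal, a covector that vanishes
  on \<open>p\<close>.\<close>

lemma unit_normal_exists:
  assumes g: "g \<in> riemannian_metrics" and p: "norm p = 1"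
    and N: "N \<in> sphere_tangent p" and NN: "metric_ext g p N N = 1"
  shows "\<exists>a. a \<noteq> 0 \<and> p \<in> equator a \<and> unit_normal g a p N"
proof -
  let ?G = "metric_ext g p"
  note bil = metric_ext_bilinear[OF g, of p]
  have lin: "linear (?G N)" using bil by (simp add: bilinear_def)
  define a where "a = (\<Sum>b\<in>Basis. ?G N b *\<^sub>R b)"
  have a: "a \<bullet> v = ?G N v" for v
  proof -
    have "a \<bullet> v = (\<Sum>b\<in>Basis. (v \<bullet> b) *\<^sub>R ?G N b)"
      by (simp add: a_def inner_commute[of _ v] inner_sum_right mult.commute)
    also have "\<dots> = ?G N (\<Sum>b\<in>Basis. (v \<bullet> b) *\<^sub>R b)"
      by (simp only: linear_sum[OF lin] linear_scale[OF lin])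
    finally show ?thesis by (simp add: euclidean_representation)
  qed
  have "a \<noteq> 0" using a[of N] NN by auto
  moreover have "p \<in> equator a" using a[of p] metric_ext_self[OF g p] p by (simp add: equator_def)
  moreover have "unit_normal g a p N"
    unfolding unit_normal_def equator_tangent_def
  proof (intro conjI ballI N)
    show "g p N N = 1" using NN N by (simp add: metric_ext_eq)
    fix v assume "v \<in> {v. v \<bullet> p = 0 \<and> a \<bullet> v = 0}"
    then have "v \<in> sphere_tangent p" "?G N v = 0" using a by (auto simp: sphere_tangent_def)
    then show "g p N v = 0" using N by (simp add: metric_ext_eq)
  qed
  ultimately show ?thesis by blast
qed

text \<open>Vanishing of the mean curvature for all unit normals is, by homogeneity, the cubic identity with
  \<open>l = metric_div - metric_trace / 2\<close>; its trace forces \<open>l = metric_trace / (n + 1)\<close>. In the other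
  direction the same trace identity recovers the divergence from \<open>metric_trace\<close>.\<close>

lemma equator_minimal_iff_cubic:
  fixes g :: "'v::euclidean_space metric"
  assumes g: "g \<in> riemannian_metrics"
  shows "g \<in> equator_minimal_metrics \<longleftrightarrow>
    (\<forall>p E N. norm p = 1 \<longrightarrow> tangent_basis g p E \<longrightarrow> N \<in> sphere_tangent p \<longrightarrow>
      metric_deriv g p N N N = 2 / real DIM('v) * metric_trace g p E N * metric_ext g p N N)"
    (is "?L \<longleftrightarrow> ?R")
proof
  assume L: ?L
  show ?R
  proof (intro allI impI)
    fix p :: 'v and E N assume p: "norm p = 1" and E: "tangent_basis g p E" and N: "N \<in> sphere_tangent p"
    let ?G = "metric_ext g p" and ?T = "metric_deriv g p"
    note bil = metric_ext_bilinear[OF g, of p] and T1 = metric_deriv_linear[OF g p]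
      and T2 = metric_deriv_bilinear[OF g p]
    define l where "l X = metric_div g p E X - metric_trace g p E X / 2" for X
    have l: "linear l"
      using metric_trace_linear[OF g p, of E] unfolding l_def[abs_def]
      by (auto simp: linear_iff add_divide_distrib right_diff_distrib)
    have cub: "?T M M M = 2 * l M * ?G M M" if M: "M \<in> sphere_tangent p" for M
    proof (cases "M = 0")
      case True
      then show ?thesis using bilinear_lzero[OF T2] bilinear_lzero[OF bil] by simp
    next
      case False
      then have pos: "?G M M > 0" using metric_ext_pos[OF g p M] by simp
      define c where "c = sqrt (?G M M)"
      have c: "c > 0" "c * c = ?G M M" using pos by (auto simp: c_def)
      define N where "N = (1 / c) *\<^sub>R M"
      have MN: "M = c *\<^sub>R N" using c by (simp add: N_def)
      have N: "N \<in> sphere_tangent p" using M by (simp add: N_def sphere_tangent_def)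
      have "c * c * ?G N N = c * c"
        using c(2) unfolding MN by (simp add: bilinear_lmul[OF bil] bilinear_rmul[OF bil])
      then have NN: "?G N N = 1" using c pos by auto
      obtain a where "a \<noteq> 0" "p \<in> equator a" "unit_normal g a p N"
        using unit_normal_exists[OF g p N NN] by blast
      then have "mean_curvature g a p N = 0"
        using L unfolding equator_minimal_metrics_def minimal_equator_def by blast
      then have "?T N N N = 2 * l N"
        using mean_curvature_eq[OF g p E \<open>unit_normal g a p N\<close>] by (simp add: l_def)
      then show ?thesis unfolding MN
        by (simp add: linear_scale[OF T1] bilinear_lmul[OF T2] bilinear_rmul[OF T2] linear_scale[OF l]
            bilinear_lmul[OF bil] bilinear_rmul[OF bil] NN)
    qed
    have onE: "form_orthonormal ?G E" and sE: "span E = sphere_tangent p"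
      using E by (auto simp: tangent_basis_def)
    have "metric_trace g p E N + 2 * metric_div g p E N = 2 * (real (card E) + 2) * l N"
      unfolding metric_trace_def metric_div_def
      by (rule cubic_identity_trace[OF bil metric_ext_sym[OF g] onE T1 T2 metric_deriv_sym[OF g] l])
        (use cub sE N in auto)
    then have "metric_trace g p E N = real DIM('v) * l N"
    proof -
      have "metric_div g p E N = l N + metric_trace g p E N / 2" by (simp add: l_def)
      then show ?thesis
        using \<open>metric_trace g p E N + 2 * metric_div g p E N = _\<close> tangent_basis_card(2)[OF g p E, symmetric]
        by (simp add: field_simps)
    qed
    then show "?T N N N = 2 / real DIM('v) * metric_trace g p E N * ?G N N" using cub[OF N] by simp
  qed
next
  assume R: ?R
  have "minimal_equator g a" if "a \<noteq> 0" for a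
    unfolding minimal_equator_def
  proof (intro ballI allI impI)
    fix p N assume "p \<in> equator a" and u: "unit_normal g a p N"
    then have p: "norm p = 1" by (simp add: equator_def)
    have N: "N \<in> sphere_tangent p" and NN: "metric_ext g p N N = 1"
      using u by (auto simp: unit_normal_def metric_ext_eq)
    obtain E where E: "tangent_basis g p E" using tangent_basis_exists[OF g p] by blast
    have onE: "form_orthonormal (metric_ext g p) E" and sE: "span E = sphere_tangent p"
      using E by (auto simp: tangent_basis_def)
    define l where "l = (\<lambda>X. (1 / real DIM('v)) *\<^sub>R metric_trace g p E X)"
    have l: "linear l" unfolding l_def by (rule linear_compose_scale_right[OF metric_trace_linear(1)[OF g p]])
    have tr: "metric_trace g p E N + 2 * metric_div g p E N = 2 * (real (card E) + 2) * l N"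
      unfolding metric_trace_def[of g p E N] metric_div_def
      by (rule cubic_identity_trace[OF metric_ext_bilinear[OF g, of p] metric_ext_sym[OF g] onE metric_deriv_linear[OF g p]
            metric_deriv_bilinear[OF g p] metric_deriv_sym[OF g] l])
        (use R p E sE N in \<open>auto simp: l_def\<close>)
    have cub: "metric_deriv g p N N N = 2 * l N" using R p E N NN by (simp add: l_def)
    define L where "L = l N"
    have "metric_trace g p E N = (real (card E) + 1) * L"
      unfolding L_def l_def using tangent_basis_card(2)[OF g p E] by simp
    then show "mean_curvature g a p N = 0"
      unfolding mean_curvature_eq[OF g p E u] cub using tr unfolding L_def[symmetric]
      by (simp add: field_simps)
  qed
  then show ?L using g unfolding equator_minimal_metrics_def by simp
qed

section \<open>Minimality of all equators as a Killing equation\<close>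

lemma metric_deriv_self:
  assumes g: "g \<in> riemannian_metrics" and x: "norm x = 1"
  shows "metric_deriv g x X x x = 0"
proof -
  have "((\<lambda>y. metric_ext g (y /\<^sub>R norm y) (y /\<^sub>R norm y) x) has_derivative
     (\<lambda>X. metric_deriv g x X (x /\<^sub>R norm x) x + metric_ext g (x /\<^sub>R norm x) (X - (X \<bullet> x) *\<^sub>R x) x
        + metric_ext g (x /\<^sub>R norm x) (x /\<^sub>R norm x) 0)) (at x)"
    by (rule has_derivative_bilinear_family[of "\<lambda>y. metric_ext g (y /\<^sub>R norm y)",
          OF metric_ext_bilinear[OF g] metric_ext_has_derivative[OF g x] has_derivative_radial[OF x] has_derivative_const])
  moreover have "(\<lambda>y. metric_ext g (y /\<^sub>R norm y) (y /\<^sub>R norm y) x) = (\<lambda>y. 0)"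
  proof
    fix y :: 'a
    show "metric_ext g (y /\<^sub>R norm y) (y /\<^sub>R norm y) x = 0"
    proof (cases "y = 0")
      case True
      then show ?thesis using bilinear_lzero[OF metric_ext_bilinear[OF g]] by simp
    next
      case False
      then show ?thesis by (intro metric_ext_self[OF g]) simp
    qed
  qed
  ultimately have "((\<lambda>y. 0) has_derivative (\<lambda>X. metric_deriv g x X x x)) (at x)"
    using x metric_ext_self[OF g x] by simp
  from fun_cong[OF has_derivative_unique[OF this has_derivative_const]] show ?thesis by simp
qed

definition metric_det :: "(real^'m) metric \<Rightarrow> real^'m \<Rightarrow> real" where
  "metric_det g x = tangent_det (metric_ext g x) x"

text \<open>Jacobi's formula. A fixed change of basis makes the matrix of the metric the identity at \<open>x\<close>, where
  the derivative of the determinant is the trace. The entry of the direction \<open>x\<close> contributes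
  nothing, since \<open>metric_ext g y x x\<close> and its derivative vanish at \<open>y = x\<close>.\<close>

lemma metric_det_has_derivative:
  fixes g :: "(real^'m) metric"
  assumes g: "g \<in> riemannian_metrics" and x: "norm x = 1" and E: "tangent_basis g x E"
  shows "metric_det g x > 0"
    "((\<lambda>y. metric_det g (y /\<^sub>R norm y)) has_derivative (\<lambda>X. metric_det g x * metric_trace g x E X)) (at x)"
proof -
  let ?G = "metric_ext g"
  have on: "form_orthonormal (?G x) E" and s: "span E = sphere_tangent x"
    using E by (auto simp: tangent_basis_def)
  obtain L :: "real^'m^'m" and f where f: "bij_betw f UNIV (insert x E)" and L: "\<And>i. L *v axis i 1 = f i"
    and I: "form_matrix (\<lambda>u v. filled_form (?G x) x (L *v u) (L *v v)) = mat 1"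
    using adapted_matrix_exists[OF metric_ext_bilinear[OF g] x on s metric_ext_self[OF g x]] by auto
  have finE: "finite E" by (rule tangent_basis_card(1)[OF g x E])
  have xx: "x \<bullet> x = 1" using x by (simp add: dot_square_norm)
  have Ex: "x \<bullet> e = 0" if "e \<in> E" for e
    using that s span_base[of e E] by (simp add: sphere_tangent_def inner_commute)
  then have xE: "x \<notin> E" using xx by force
  define A where "A y = form_matrix (\<lambda>u v. filled_form (?G y) y (L *v u) (L *v v))" for y
  have A: "det (A y) = det L ^ 2 * metric_det g y" for y
    unfolding A_def metric_det_def tangent_det_def
    by (rule det_form_congruence[OF filled_form_bilinear[OF metric_ext_bilinear[OF g]]])
  have "det (A x) = 1" unfolding A_def I by simp
  then have one: "det L ^ 2 * metric_det g x = 1" using A by simp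
  moreover have "det L ^ 2 \<ge> 0" by simp
  ultimately show pos: "metric_det g x > 0"
    by (metis mult_nonneg_nonpos not_le zero_less_one)
  let ?r = "\<lambda>y :: real^'m. y /\<^sub>R norm y" and ?r' = "\<lambda>X. X - (X \<bullet> x) *\<^sub>R x"
  have "((\<lambda>y. A (?r y) $ i $ j) has_derivative
      (\<lambda>X. metric_deriv g x X (f i) (f j) + ((?r x \<bullet> f i) * (?r' X \<bullet> f j) + (?r' X \<bullet> f i) * (?r x \<bullet> f j)))) (at x)" for i j
    unfolding A_def form_matrix_def filled_form_def vec_lambda_beta L
    by (intro has_derivative_add metric_ext_has_derivative[OF g x] has_derivative_mult has_derivative_inner_left
        has_derivative_radial[OF x])
  then have "((\<lambda>y. det (A (?r y))) has_derivative (\<lambda>X. \<Sum>i\<in>UNIV. metric_deriv g x X (f i) (f i)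
      + ((?r x \<bullet> f i) * (?r' X \<bullet> f i) + (?r' X \<bullet> f i) * (?r x \<bullet> f i)))) (at x)"
    by (rule has_derivative_det_at_identity) (simp add: x A_def I)
  moreover have "(\<Sum>i\<in>UNIV. metric_deriv g x X (f i) (f i)
      + ((?r x \<bullet> f i) * (?r' X \<bullet> f i) + (?r' X \<bullet> f i) * (?r x \<bullet> f i))) = metric_trace g x E X" for X
  proof -
    have r'x: "?r' X \<bullet> x = 0" by (simp add: inner_diff_left xx)
    have "(\<Sum>i\<in>UNIV. metric_deriv g x X (f i) (f i)
      + ((?r x \<bullet> f i) * (?r' X \<bullet> f i) + (?r' X \<bullet> f i) * (?r x \<bullet> f i)))
      = (\<Sum>e\<in>insert x E. metric_deriv g x X e e + ((?r x \<bullet> e) * (?r' X \<bullet> e) + (?r' X \<bullet> e) * (?r x \<bullet> e)))"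
      by (rule sum.reindex_bij_betw[OF f])
    also have "\<dots> = (\<Sum>e\<in>insert x E. metric_deriv g x X e e)"
      using Ex r'x x by (intro sum.cong) auto
    also have "\<dots> = metric_trace g x E X"
      using finE xE metric_deriv_self[OF g x] by (simp add: metric_trace_def)
    finally show ?thesis .
  qed
  ultimately have "((\<lambda>y. det L ^ 2 * metric_det g (?r y)) has_derivative metric_trace g x E) (at x)"
    by (simp add: A)
  from has_derivative_mult_right[OF this, of "metric_det g x"]
  have "((\<lambda>y. (det L ^ 2 * metric_det g x) * metric_det g (?r y)) has_derivative
      (\<lambda>X. metric_det g x * metric_trace g x E X)) (at x)"
    by (simp add: mult_ac)
  then show "((\<lambda>y. metric_det g (?r y)) has_derivative (\<lambda>X. metric_det g x * metric_trace g x E X)) (at x)"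
    by (simp add: one)
qed

text \<open>The exponent is chosen such that the logarithmic derivative of the factor cancels the right hand
  side of the cubic identity.\<close>

definition killing_form :: "(real^'m) metric \<Rightarrow> (real^'m) metric" where
  "killing_form g x u v = metric_det g x powr (- 2 / real CARD('m)) * metric_ext g x u v"

text \<open>For \<open>X = u = v\<close> the factor in parentheses is the defect of the cubic identity.\<close>

lemma killing_form_has_derivative:
  fixes g :: "(real^'m) metric"
  assumes g: "g \<in> riemannian_metrics" and x: "norm x = 1" and E: "tangent_basis g x E"
  shows "((\<lambda>y. killing_form g (y /\<^sub>R norm y) u v) has_derivative
     (\<lambda>X. metric_det g x powr (- 2 / real CARD('m)) *
       (metric_deriv g x X u v - 2 / real CARD('m) * metric_trace g x E X * metric_ext g x u v))) (at x)"
proof -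
  let ?a = "- 2 / real CARD('m)" and ?d = "metric_det g x"
  note d = metric_det_has_derivative[OF assms]
  have "((\<lambda>t. t powr ?a) has_derivative (\<lambda>h. (?a * ?d powr (?a - 1)) * h)) (at (metric_det g (x /\<^sub>R norm x)))"
  proof -
    have "x /\<^sub>R norm x = x" using x by simp
    then show ?thesis
      using has_real_derivative_powr[OF d(1), of ?a] by (simp only: has_field_derivative_def)
  qed
  from diff_chain_at[OF d(2) this]
  have 1: "((\<lambda>y. metric_det g (y /\<^sub>R norm y) powr ?a) has_derivative
      (\<lambda>X. ?a * ?d powr (?a - 1) * (?d * metric_trace g x E X))) (at x)"
    by (simp add: o_def)
  have 2: "?d powr (?a - 1) * ?d = ?d powr ?a" using d(1) by (simp add: powr_diff)
  have "(\<lambda>X. ?a * ?d powr (?a - 1) * (?d * metric_trace g x E X)) = (\<lambda>X. ?a * ?d powr ?a * metric_trace g x E X)"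
    unfolding 2[symmetric] by (simp add: mult_ac)
  with 1 have "((\<lambda>y. metric_det g (y /\<^sub>R norm y) powr ?a) has_derivative
      (\<lambda>X. ?a * ?d powr ?a * metric_trace g x E X)) (at x)" by simp
  from has_derivative_mult[OF this metric_ext_has_derivative[OF g x, of u v]]
  show ?thesis unfolding killing_form_def
    by (rule has_derivative_eq_rhs) (simp add: x fun_eq_iff algebra_simps)
qed

lemma equator_minimal_iff_killing:
  fixes g :: "(real^'m) metric"
  assumes g: "g \<in> riemannian_metrics"
  shows "g \<in> equator_minimal_metrics \<longleftrightarrow>
    (\<forall>x N. norm x = 1 \<longrightarrow> N \<in> sphere_tangent x \<longrightarrow> sphere_deriv (\<lambda>y. killing_form g y N N) x N = 0)"
proof -
  have eq: "sphere_deriv (\<lambda>y. killing_form g y N N) x N = 0 \<longleftrightarrow>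
     metric_deriv g x N N N = 2 / real DIM(real^'m) * metric_trace g x E N * metric_ext g x N N"
    if "norm x = 1" "tangent_basis g x E" for x E N
  proof -
    have "sphere_deriv (\<lambda>y. killing_form g y N N) x N = metric_det g x powr (- 2 / real CARD('m)) *
       (metric_deriv g x N N N - 2 / real CARD('m) * metric_trace g x E N * metric_ext g x N N)"
      using sphere_deriv_eqI[OF killing_form_has_derivative[OF g that, of N N]] by simp
    moreover have "metric_det g x powr (- 2 / real CARD('m)) \<noteq> 0"
      using metric_det_has_derivative(1)[OF g that] by simp
    ultimately show ?thesis by simp
  qed
  show ?thesis unfolding equator_minimal_iff_cubic[OF g] using eq tangent_basis_exists[OF g] by blast
qed

section \<open>Curvature tensors and biquadratic forms\<close>

lemma curvature_tensorD:
  assumes "algebraic_curvature_tensor R"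
  shows "linear (\<lambda>x. R x y z w)" "linear (\<lambda>y. R x y z w)" "linear (\<lambda>z. R x y z w)" "linear (\<lambda>w. R x y z w)"
    "R x y z w = - R y x z w" "R x y z w = - R x y w z" "R x y z w = R z w x y"
    "R x y z w + R x z w y + R x w y z = 0"
  using assms unfolding algebraic_curvature_tensor_def by blast+

lemma curvature_tensor_same:
  assumes "algebraic_curvature_tensor R"
  shows "R x x z w = 0" "R z w x x = 0"
  using curvature_tensorD(5)[OF assms, of x x z w] curvature_tensorD(6)[OF assms, of z w x x] by simp_all

text \<open>The polarisation in \<open>x\<close> of a form that is already bilinear in its last two arguments. For a
  biquadratic \<open>Q\<close> it is symmetric in \<open>x\<close>, \<open>z\<close> and in \<open>y\<close>, \<open>w\<close>.\<close>

definition polarized_biform :: "('v::euclidean_space \<Rightarrow> 'v \<Rightarrow> 'v \<Rightarrow> real) \<Rightarrow> 'v \<Rightarrow> 'v \<Rightarrow> 'v \<Rightarrow> 'v \<Rightarrow> real" where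
  "polarized_biform Q x z y w = (Q (x + z) y w - Q x y w - Q z y w) / 2"

text \<open>The expression of a curvature tensor by the polarisation of its biquadratic form. The factor comes from
  the first Bianchi identity, by which the difference is \<open>3 / 2\<close> times the tensor.\<close>

definition curvature_of :: "('v::euclidean_space \<Rightarrow> 'v \<Rightarrow> 'v \<Rightarrow> real) \<Rightarrow> 'v tensor4" where
  "curvature_of Q x y z w = 2 / 3 * (polarized_biform Q x z y w - polarized_biform Q x w y z)"

text \<open>Only quadraticity in the last arguments is assumed; quadraticity in \<open>x\<close>, hence multilinearity of
  the polarisation, follows from the symmetry \<open>Q x y y = Q y x x\<close>, which makes the polarisation
  invariant under exchange of its two pairs of arguments.\<close>

lemma curvature_of_biquadratic:
  fixes Q :: "'v::euclidean_space \<Rightarrow> 'v \<Rightarrow> 'v \<Rightarrow> real"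
  assumes bil: "\<And>x. bilinear (Q x)" and sym: "\<And>x u v. Q x u v = Q x v u"
    and swap: "\<And>x y. Q x y y = Q y x x" and zero: "\<And>x v. Q x x v = 0"
  shows "algebraic_curvature_tensor (curvature_of Q)" "curvature_of Q x u x v = Q x u v"
proof -
  define S where "S = polarized_biform Q"
  note Sd = polarized_biform_def[of Q, folded S_def]
  have pol: "2 * Q a u v = Q a (u + v) (u + v) - Q a u u - Q a v v" for a u v
    using sym[of a v u] by (simp add: bilinear_ladd[OF bil] bilinear_radd[OF bil])
  have Sswap: "S x z y w = S y w x z" for x y z w
  proof -
    have "4 * S x z y w = 2 * Q (x + z) y w - 2 * Q x y w - 2 * Q z y w"
      by (simp add: Sd)
    also have "\<dots> = 2 * Q (y + w) x z - 2 * Q y x z - 2 * Q w x z"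
      unfolding pol by (simp add: swap)
    also have "\<dots> = 4 * S y w x z" by (simp add: Sd)
    finally show ?thesis by simp
  qed
  have S1: "S x z y w = S z x y w" for x y z w by (simp add: Sd add.commute)
  have S2: "S x z y w = S x z w y" for x y z w by (simp add: Sd sym[of _ y w])
  have lin3: "linear (\<lambda>y. S x z y w)" for x z w
    using bil unfolding Sd bilinear_def by (auto simp: linear_iff algebra_simps diff_divide_distrib add_divide_distrib)
  have lin4: "linear (\<lambda>w. S x z y w)" for x z y
    using lin3[of x z y] by (simp only: S2[of x z y])
  have lin1: "linear (\<lambda>x. S x z y w)" for y z w
    using lin3[of y w z] by (simp only: Sswap[of _ z y w])
  have lin2: "linear (\<lambda>z. S x z y w)" for y x w
    using lin4[of y w x] by (simp only: Sswap[of x _ y w])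
  have C: "curvature_of Q x y z w = 2 / 3 * (S x z y w - S x w y z)" for x y z w
    by (simp add: curvature_of_def S_def)
  have lin: "linear (\<lambda>t. 2 / 3 * (f t - h t))" if "linear f" "linear h" for f h :: "'v \<Rightarrow> real"
    using linear_compose_scale_right[OF linear_compose_sub[OF that], of "2 / 3"] by simp
  show "algebraic_curvature_tensor (curvature_of Q)"
    unfolding algebraic_curvature_tensor_def
  proof (intro conjI allI)
    fix x y z w
    show "linear (\<lambda>x. curvature_of Q x y z w)" "linear (\<lambda>y. curvature_of Q x y z w)"
      "linear (\<lambda>z. curvature_of Q x y z w)" "linear (\<lambda>w. curvature_of Q x y z w)"
      unfolding C by (intro lin lin1 lin2 lin3 lin4)+
    show "curvature_of Q x y z w = - curvature_of Q y x z w"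
      unfolding C Sswap[of x z y w] Sswap[of x w y z] by (simp only: mult_minus_right[symmetric] minus_diff_eq)
    show "curvature_of Q x y z w = - curvature_of Q x y w z"
      unfolding C by (simp only: mult_minus_right[symmetric] minus_diff_eq)
    show "curvature_of Q x y z w = curvature_of Q z w x y"
      unfolding C using S1[of x z y w] S2[of z x y w] S1[of z y w x] S2[of y z w x] Sswap[of y z x w] by simp
    show "curvature_of Q x y z w + curvature_of Q x z w y + curvature_of Q x w y z = 0"
      unfolding C using S2[of x z y w] S2[of x w y z] S2[of x y z w] by (simp add: diff_divide_distrib)
  qed
  show "curvature_of Q x u x v = Q x u v"
  proof -
    have "Q (x + x) a a = 4 * Q x a a" for a
      using swap[of "x + x" a] swap[of x a] by (simp add: bilinear_ladd[OF bil] bilinear_radd[OF bil])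
    then have "2 * Q (x + x) u v = 8 * Q x u v" unfolding pol[of "x + x"] using pol[of x u v] by simp
    then have 1: "S x x u v = Q x u v" by (simp add: Sd)
    have z: "S a a a v = 0" for a
    proof -
      have "Q (a + a) a v = 0"
        using zero[of "a + a" v] by (simp add: bilinear_ladd[OF bil])
      then show ?thesis by (simp add: Sd zero)
    qed
    \<comment> \<open>The form vanishes when its first three arguments agree; polarising this determines \<open>S x u x v\<close>.\<close>
    have "S (x + u) (x + u) (x + u) v - S (x - u) (x - u) (x - u) v = 2 * (S x x u v + 2 * S x u x v) + 2 * S u u u v"
      using S1[of u x x v] S1[of u x u v]
      by (simp add: linear_add[OF lin1] linear_add[OF lin2] linear_add[OF lin3]
          linear_diff[OF lin1] linear_diff[OF lin2] linear_diff[OF lin3])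
    then have "S x x u v + 2 * S x u x v = 0" by (simp add: z)
    moreover have "S x u x v = S x v u x" using Sswap[of x u x v] S2[of x v x u] by simp
    ultimately show ?thesis unfolding C using 1 by simp
  qed
qed

text \<open>Polarising in the first argument gives \<open>R x y z w + R z y x w\<close>, and two such sums determine
  \<open>3 * R x y z w\<close> by the Bianchi identity.\<close>

lemma curvature_tensor_eqI:
  assumes R: "algebraic_curvature_tensor R" and R': "algebraic_curvature_tensor R'"
    and eq: "\<And>x u v. R x u x v = R' x u x v"
  shows "R = R'"
proof -
  have "R x y z w = R' x y z w" for x y z w
  proof -
    have pol: "T (x + z) y (x + z) w = T x y x w + T z y z w + T x y z w + T z y x w"
      if "algebraic_curvature_tensor T" for T x y z w
    proof -
      have "linear (\<lambda>x. T x y z w)" "linear (\<lambda>z. T x y z w)" for x z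
        using that unfolding algebraic_curvature_tensor_def by blast+
      from this[THEN linear_add] show ?thesis by simp
    qed
    have 1: "R x y z w + R z y x w = R' x y z w + R' z y x w" for x y z w
      using pol[OF R, of x z y w] pol[OF R', of x z y w] eq by simp
    have id: "3 * T x y z w = (T x y z w + T z y x w) - (T x y w z + T w y x z)"
      if "algebraic_curvature_tensor T" for T
    proof -
      have c: "T x y z w = - T y x z w" "T x y z w = - T x y w z" "T x y z w = T z w x y"
        "T x y z w + T x z w y + T x w y z = 0" for x y z w
        using that unfolding algebraic_curvature_tensor_def by blast+
      show ?thesis using c(2)[of x y z w] c(3)[of z y x w] c(2)[of x w z y] c(3)[of w y x z] c(4)[of x y z w] by simp
    qed
    show ?thesis using id[OF R] id[OF R'] 1[of x y z w] 1[of x y w z] by simp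
  qed
  then show ?thesis by (intro ext)
qed

section \<open>Killing forms are Jacobi forms of curvature tensors\<close>

lemma killing_form_bilinear: "g \<in> riemannian_metrics \<Longrightarrow> bilinear (killing_form g x)"
  using metric_ext_bilinear[of g x] unfolding bilinear_def killing_form_def by (auto simp: linear_iff algebra_simps)

lemma killing_form_sym: "g \<in> riemannian_metrics \<Longrightarrow> killing_form g x u v = killing_form g x v u"
  by (simp add: killing_form_def metric_ext_sym[of g x u v])

lemma killing_form_self:
  assumes "g \<in> riemannian_metrics"
  shows "killing_form g x x v = 0" "killing_form g x v x = 0"
proof -
  have "metric_ext g x x v = 0 \<and> metric_ext g x v x = 0"
    using metric_ext_self[OF assms] riemannian_zero[OF assms] by (cases "norm x = 1") (auto simp: metric_ext_def)
  then show "killing_form g x x v = 0" "killing_form g x v x = 0" by (simp_all add: killing_form_def)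
qed

text \<open>The acceleration of a great circle is minus the position vector, which is in the kernel of the form, so
  the derivative of the value on the velocity is \<open>(D\<^sub>N k) N N = 0\<close>.\<close>

lemma killing_form_constant_along_great_circle:
  fixes g :: "(real^'m) metric"
  assumes g: "g \<in> equator_minimal_metrics" and x: "norm x = 1" and v: "norm v = 1" and xv: "x \<bullet> v = 0"
  shows "killing_form g (cos t *\<^sub>R x + sin t *\<^sub>R v) (cos t *\<^sub>R v - sin t *\<^sub>R x) (cos t *\<^sub>R v - sin t *\<^sub>R x)
    = killing_form g x v v"
proof -
  have gr: "g \<in> riemannian_metrics" using g by (simp add: equator_minimal_metrics_def)
  note K = g[unfolded equator_minimal_iff_killing[OF gr], rule_format]
  define c where "c t = cos t *\<^sub>R x + sin t *\<^sub>R v" for t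
  define c' where "c' t = cos t *\<^sub>R v - sin t *\<^sub>R x" for t
  have xx: "x \<bullet> x = 1" "v \<bullet> v = 1" "v \<bullet> x = 0" using x v xv by (auto simp: dot_square_norm inner_commute)
  have nc: "norm (c t) = 1" for t
  proof -
    have "c t \<bullet> c t = (cos t)^2 + (sin t)^2"
      unfolding c_def by (simp add: inner_add_left inner_add_right xx xv power2_eq_square)
    then show ?thesis by (simp add: norm_eq_sqrt_inner)
  qed
  have tc: "c' t \<in> sphere_tangent (c t)" for t
    unfolding c_def c'_def sphere_tangent_def by (simp add: inner_add_right inner_diff_left xx xv)
  have dc: "(c has_derivative (\<lambda>s. s *\<^sub>R c' t)) (at t)" for t
    unfolding c_def[abs_def] c'_def
    by (auto intro!: derivative_eq_intros simp: algebra_simps fun_eq_iff)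
  have dc': "(c' has_derivative (\<lambda>s. s *\<^sub>R (- c t))) (at t)" for t
    unfolding c_def c'_def[abs_def]
    by (auto intro!: derivative_eq_intros simp: algebra_simps fun_eq_iff)
  have "((\<lambda>t. killing_form g (c t) (c' t) (c' t)) has_derivative (\<lambda>s. 0)) (at t)" for t
  proof -
    obtain E where E: "tangent_basis g (c t) E" using tangent_basis_exists[OF gr nc] by blast
    define D where "D u v = sphere_deriv (\<lambda>y. killing_form g y u v) (c t)" for u v
    have D: "((\<lambda>y. killing_form g (y /\<^sub>R norm y) u v) has_derivative D u v) (at (c t))" for u v
      using killing_form_has_derivative[OF gr nc E, of u v] sphere_deriv_eqI[OF killing_form_has_derivative[OF gr nc E, of u v]]
      unfolding D_def by simp
    have "((\<lambda>t. killing_form g (c t) u v) has_derivative (\<lambda>s. D u v (s *\<^sub>R c' t))) (at t)" for u v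
      using diff_chain_at[OF dc D] by (simp add: o_def nc)
    from has_derivative_bilinear_family[OF killing_form_bilinear[OF gr] this dc' dc']
    have "((\<lambda>t. killing_form g (c t) (c' t) (c' t)) has_derivative
       (\<lambda>s. D (c' t) (c' t) (s *\<^sub>R c' t) + killing_form g (c t) (s *\<^sub>R (- c t)) (c' t)
         + killing_form g (c t) (c' t) (s *\<^sub>R (- c t)))) (at t)" .
    moreover have "D (c' t) (c' t) (s *\<^sub>R c' t) = 0" for s
    proof -
      have "D (c' t) (c' t) (c' t) = 0" unfolding D_def by (rule K[OF nc tc])
      then show ?thesis using linear_scale[OF has_derivative_linear[OF D]] by simp
    qed
    moreover note b = killing_form_bilinear[OF gr]
    ultimately show ?thesis
      by (simp add: bilinear_lmul[OF b] bilinear_rmul[OF b] bilinear_lneg[OF b] bilinear_rneg[OF b] killing_form_self[OF gr])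
  qed
  then have "killing_form g (c t) (c' t) (c' t) = killing_form g (c 0) (c' 0) (c' 0)"
    by (intro DERIV_isconst_all) (simp add: has_field_derivative_def lambda_zero)
  then show ?thesis by (simp add: c_def c'_def)
qed

text \<open>The extension to pairs of arbitrary vectors that is homogeneous of degree two in each argument.\<close>

definition killing_biquadratic :: "(real^'m) metric \<Rightarrow> (real^'m) metric" where
  "killing_biquadratic g x u v = (norm x)\<^sup>2 * killing_form g (x /\<^sub>R norm x) u v"

text \<open>For orthonormal \<open>e\<close>, \<open>f\<close> with \<open>x\<close> a multiple of \<open>e\<close> and \<open>y\<close> in the plane of \<open>e\<close>, \<open>f\<close>, rotating the
  pair \<open>(e, f)\<close> until \<open>e\<close> points along \<open>y\<close> does not change the value of the form. Both sides are
  therefore the squared area of the parallelogram spanned by \<open>x\<close>, \<open>y\<close> times \<open>killing_form g e f f\<close>.\<close>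

lemma killing_biquadratic_symmetric:
  fixes g :: "(real^'m) metric"
  assumes g: "g \<in> equator_minimal_metrics"
  shows "killing_biquadratic g x y y = killing_biquadratic g y x x"
proof -
  have gr: "g \<in> riemannian_metrics" using g by (simp add: equator_minimal_metrics_def)
  note b = killing_form_bilinear[OF gr] and s = killing_form_self[OF gr]
  note l = bilinear_ladd[OF b] bilinear_radd[OF b] bilinear_lmul[OF b] bilinear_rmul[OF b]
    bilinear_lzero[OF b] bilinear_rzero[OF b] bilinear_lsub[OF b] bilinear_rsub[OF b]
  show ?thesis
  proof (cases "x = 0 \<or> y = 0")
    case True
    then show ?thesis by (auto simp: killing_biquadratic_def l)
  next
    case False
    then have x0: "x \<noteq> 0" and y0: "y \<noteq> 0" by auto
    define e where "e = x /\<^sub>R norm x"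
    define p where "p = y \<bullet> e"
    define f0 where "f0 = y - p *\<^sub>R e"
    have ne: "norm e = 1" and xe: "x = norm x *\<^sub>R e" using x0 by (auto simp: e_def)
    have ee: "e \<bullet> e = 1" using ne by (simp add: dot_square_norm)
    show ?thesis
    proof (cases "f0 = 0")
      case True
      then have y: "y = p *\<^sub>R e" by (simp add: f0_def)
      then have p: "p \<noteq> 0" using y0 by auto
      have "killing_form g (y /\<^sub>R norm y) (y /\<^sub>R norm y) v = 0" for v by (rule s)
      then have "killing_form g (y /\<^sub>R norm y) y v = 0" for v using y0 by (simp add: l)
      then have "killing_form g (y /\<^sub>R norm y) (p *\<^sub>R e) v = 0" for v using y by simp
      then have "killing_form g (y /\<^sub>R norm y) e v = 0" for v using p by (simp add: l)
      then have "killing_form g (y /\<^sub>R norm y) x x = 0" 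
      proof -
        assume "\<And>v. killing_form g (y /\<^sub>R norm y) e v = 0"
        then have "killing_form g (y /\<^sub>R norm y) (norm x *\<^sub>R e) x = 0" by (simp add: l)
        then show ?thesis unfolding xe[symmetric] .
      qed
      moreover have "killing_form g e y y = 0" unfolding y using s by (simp add: l)
      ultimately show ?thesis by (simp add: killing_biquadratic_def e_def)
    next
      case False
      define q where "q = norm f0"
      define f where "f = f0 /\<^sub>R q"
      have q: "q > 0" using False by (simp add: q_def)
      have nf: "norm f = 1" using False by (simp add: f_def q_def)
      have y: "y = p *\<^sub>R e + q *\<^sub>R f" using q by (simp add: f_def f0_def)
      have ef: "e \<bullet> f = 0"
        using ee by (simp add: f_def f0_def p_def inner_diff_right inner_commute)
      have "y \<bullet> y = p\<^sup>2 + q\<^sup>2"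
      proof -
        have "f \<bullet> f = 1" "f \<bullet> e = 0" using nf ef by (auto simp: dot_square_norm inner_commute)
        then show ?thesis unfolding y using ee ef
          by (simp add: inner_add_left inner_add_right power2_eq_square)
      qed
      then have ny: "(norm y)\<^sup>2 = p\<^sup>2 + q\<^sup>2" by (simp add: dot_square_norm)
      have "(p / norm y)\<^sup>2 + (q / norm y)\<^sup>2 = 1"
      proof -
        have "(p / norm y)\<^sup>2 + (q / norm y)\<^sup>2 = (p\<^sup>2 + q\<^sup>2) / (norm y)\<^sup>2"
          by (simp add: power_divide add_divide_distrib)
        also have "\<dots> = 1" unfolding ny[symmetric] using y0 by simp
        finally show ?thesis .
      qed
      then obtain t where t: "p / norm y = cos t" "q / norm y = sin t"
        using sincos_total_2pi[of "p / norm y" "q / norm y"] by metis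
      let ?d = "cos t *\<^sub>R e + sin t *\<^sub>R f" and ?d' = "cos t *\<^sub>R f - sin t *\<^sub>R e"
      have yd: "y /\<^sub>R norm y = ?d"
        unfolding t[symmetric] using y by (simp add: scaleR_add_right divide_inverse mult.commute)
      have "a *\<^sub>R (a *\<^sub>R e + b *\<^sub>R f) - b *\<^sub>R (a *\<^sub>R f - b *\<^sub>R e) = (a * a + b * b) *\<^sub>R e" for a b
        by (simp add: algebra_simps)
      \<comment> \<open>The vector \<open>e\<close> in the rotated orthonormal pair.\<close>
      from this[of "cos t" "sin t"] have ed: "e = cos t *\<^sub>R ?d - sin t *\<^sub>R ?d'" by simp
      have "killing_form g ?d e e = killing_form g ?d (cos t *\<^sub>R ?d - sin t *\<^sub>R ?d') (cos t *\<^sub>R ?d - sin t *\<^sub>R ?d')"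
        using ed by simp
      also have "\<dots> = (sin t)\<^sup>2 * killing_form g ?d ?d' ?d'"
        unfolding bilinear_lsub[OF b] bilinear_rsub[OF b] bilinear_lmul[OF b] bilinear_rmul[OF b] s
        by (simp add: power2_eq_square algebra_simps)
      also have "\<dots> = (q / norm y)\<^sup>2 * killing_form g e f f"
        unfolding killing_form_constant_along_great_circle[OF g ne nf ef] t ..
      finally have d: "killing_form g (y /\<^sub>R norm y) e e = (q / norm y)\<^sup>2 * killing_form g e f f" using yd by simp
      have "killing_form g z (norm x *\<^sub>R e) (norm x *\<^sub>R e) = (norm x)\<^sup>2 * killing_form g z e e" for z
        by (simp add: l power2_eq_square)
      note kxx = this[unfolded xe[symmetric]]
      have "killing_biquadratic g y x x = (norm y)\<^sup>2 * ((norm x)\<^sup>2 * killing_form g (y /\<^sub>R norm y) e e)"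
        unfolding killing_biquadratic_def kxx ..
      also have "\<dots> = (norm x)\<^sup>2 * q\<^sup>2 * killing_form g e f f"
        unfolding d using y0 by (simp add: power_divide)
      also have "\<dots> = killing_biquadratic g x y y"
        unfolding killing_biquadratic_def e_def[symmetric] y using s by (simp add: l power2_eq_square)
      finally show ?thesis by simp
    qed
  qed
qed

lemma killing_form_curvature:
  fixes g :: "(real^'m) metric"
  assumes g: "g \<in> equator_minimal_metrics"
  shows "\<exists>R \<in> positive_curvature_tensors. \<forall>x u v. norm x = 1 \<longrightarrow> killing_form g x u v = R x u x v"
proof -
  have gr: "g \<in> riemannian_metrics" using g by (simp add: equator_minimal_metrics_def)
  note b = killing_form_bilinear[OF gr]
  let ?R = "curvature_of (killing_biquadratic g)"
  have bil: "bilinear (killing_biquadratic g x)" for x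
    using b[of "x /\<^sub>R norm x"] unfolding bilinear_def killing_biquadratic_def by (auto simp: linear_iff algebra_simps)
  have sym: "killing_biquadratic g x u v = killing_biquadratic g x v u" for x u v
    by (simp add: killing_biquadratic_def killing_form_sym[OF gr, of _ u v])
  have zero: "killing_biquadratic g x x v = 0" for x v
  proof (cases "x = 0")
    case False
    have "killing_form g (x /\<^sub>R norm x) (x /\<^sub>R norm x) v = 0" by (rule killing_form_self[OF gr])
    then have "killing_form g (x /\<^sub>R norm x) x v = 0" using False by (simp add: bilinear_lmul[OF b])
    then show ?thesis by (simp add: killing_biquadratic_def)
  qed (simp add: killing_biquadratic_def)
  note R = curvature_of_biquadratic[OF bil sym killing_biquadratic_symmetric[OF g] zero]
  have eq: "killing_form g x u v = ?R x u x v" if "norm x = 1" for x u v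
    unfolding R(2) using that by (simp add: killing_biquadratic_def)
  moreover have "?R \<in> positive_curvature_tensors"
    unfolding positive_curvature_tensors_def
  proof (intro CollectI conjI R(1) allI impI)
    fix v w :: "real^'m" assume vw: "norm v = 1" "norm w = 1" "v \<bullet> w = 0"
    then have w: "w \<in> sphere_tangent v" by (simp add: sphere_tangent_def inner_commute)
    obtain E where "tangent_basis g v E" using tangent_basis_exists[OF gr vw(1)] by blast
    then have "metric_det g v > 0" using metric_det_has_derivative(1)[OF gr vw(1)] by blast
    moreover have "metric_ext g v w w > 0" using metric_ext_pos[OF gr vw(1) w] vw(2) by force
    ultimately have "killing_form g v w w > 0" by (simp add: killing_form_def)
    then show "?R v w v w > 0" using eq vw(1) by simp
  qed
  ultimately show ?thesis by blast
qed

section \<open>The metric of a curvature tensor\<close>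

lemma jacobi_form_bilinear: "algebraic_curvature_tensor R \<Longrightarrow> bilinear (\<lambda>u v. R x u x v)"
  unfolding bilinear_def using curvature_tensorD(2,4) by blast

text \<open>Positivity for orthonormal pairs gives positivity for all linearly independent ones, because
  \<open>R x u x u\<close> does not see the component of \<open>u\<close> along \<open>x\<close>. The second assumption says that \<open>u\<close> is
  not a multiple of \<open>x\<close>.\<close>

lemma positive_curvatureD:
  assumes R: "R \<in> positive_curvature_tensors"
  shows "algebraic_curvature_tensor R"
    "x \<noteq> 0 \<Longrightarrow> u - (u \<bullet> (x /\<^sub>R norm x)) *\<^sub>R (x /\<^sub>R norm x) \<noteq> 0 \<Longrightarrow> R x u x u > 0"
proof -
  show a: "algebraic_curvature_tensor R" using R by (simp add: positive_curvature_tensors_def)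
  note lin = curvature_tensorD(1-4)[OF a]
  assume x0: "x \<noteq> 0" and "u - (u \<bullet> (x /\<^sub>R norm x)) *\<^sub>R (x /\<^sub>R norm x) \<noteq> 0"
  define e where "e = x /\<^sub>R norm x"
  define f where "f = u - (u \<bullet> e) *\<^sub>R e"
  have f0: "f \<noteq> 0" unfolding f_def e_def by fact
  have ne: "norm e = 1" and xe: "norm x *\<^sub>R e = x" using x0 by (auto simp: e_def)
  have ef: "e \<bullet> f = 0" using ne by (simp add: f_def inner_diff_right inner_commute dot_square_norm)
  have "R e (f /\<^sub>R norm f) e (f /\<^sub>R norm f) > 0"
    using R ne f0 ef unfolding positive_curvature_tensors_def by auto
  then have "R e f e f > 0"
    using f0 by (simp add: linear_scale[OF lin(2)] linear_scale[OF lin(4)] zero_less_mult_iff)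
  also have "R e f e f = R e u e u"
    unfolding f_def by (simp add: linear_diff[OF lin(2)] linear_diff[OF lin(4)] linear_scale[OF lin(2)]
        linear_scale[OF lin(4)] curvature_tensor_same[OF a])
  finally have "R (norm x *\<^sub>R e) u (norm x *\<^sub>R e) u > 0"
    using x0 by (simp add: linear_scale[OF lin(1)] linear_scale[OF lin(3)])
  then show "R x u x u > 0" unfolding xe .
qed

lemma jacobi_form_pos:
  assumes R: "R \<in> positive_curvature_tensors" and x: "norm x = 1" and "u \<in> sphere_tangent x" "u \<noteq> 0"
  shows "R x u x u > 0"
  using positive_curvatureD(2)[OF R, of x u] assms by (force simp: sphere_tangent_def)

definition jacobi_det :: "(real^'m) tensor4 \<Rightarrow> real^'m \<Rightarrow> real" where
  "jacobi_det R x = tangent_det (\<lambda>u v. R x u x v) x"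

lemma jacobi_det_pos:
  assumes R: "R \<in> positive_curvature_tensors" and x: "norm x = 1"
  shows "jacobi_det R x > 0"
proof -
  note a = positive_curvatureD(1)[OF R]
  show ?thesis unfolding jacobi_det_def
    using curvature_tensorD(7)[OF a] curvature_tensor_same[OF a]
    by (intro tangent_det_pos[OF jacobi_form_bilinear[OF a] _ x] jacobi_form_pos[OF R x]) auto
qed

text \<open>The inverse of the correspondence. The exponent is \<open>2 / (1 - n)\<close> for the sphere of dimension
  \<open>n = CARD('m) - 1\<close>; it undoes the rescaling in \<open>killing_form\<close>.\<close>

definition curvature_metric :: "(real^'m) tensor4 \<Rightarrow> (real^'m) metric" where
  "curvature_metric R x u v =
    (if norm x = 1 \<and> u \<in> sphere_tangent x \<and> v \<in> sphere_tangent x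
     then jacobi_det R x powr (2 / (2 - real CARD('m))) * R x u x v else 0)"

lemma smooth_on_multilinear:
  fixes R :: "'v::euclidean_space tensor4"
  assumes a: "algebraic_curvature_tensor R"
    and X: "smooth_on X S" "smooth_on Y S" "smooth_on Z S" "smooth_on W S"
  shows "smooth_on (\<lambda>x. R (X x) (Y x) (Z x) (W x)) S"
proof -
  note lin = curvature_tensorD(1-4)[OF a]
  have expand: "R x y z w = (\<Sum>i\<in>Basis. (x \<bullet> i) * (\<Sum>j\<in>Basis. (y \<bullet> j) * (\<Sum>k\<in>Basis. (z \<bullet> k) * (\<Sum>l\<in>Basis. (w \<bullet> l) * R i j k l))))" for x y z w
  proof -
    have e: "f u = (\<Sum>i\<in>Basis. (u \<bullet> i) * f i)" if "linear f" for f :: "'v \<Rightarrow> real" and u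
    proof -
      have "f u = f (\<Sum>i\<in>Basis. (u \<bullet> i) *\<^sub>R i)" by (simp add: euclidean_representation)
      also have "\<dots> = (\<Sum>i\<in>Basis. (u \<bullet> i) * f i)"
        by (simp only: linear_sum[OF that] linear_scale[OF that] real_scaleR_def)
      finally show ?thesis .
    qed
    show ?thesis
      by (subst e[OF lin(1)], subst e[OF lin(2)], subst e[OF lin(3)], subst e[OF lin(4)]) simp
  qed
  show ?thesis
    by (subst expand) (intro smooth_on_sum smooth_on_bilinear[OF bounded_bilinear_mult] smooth_on_const
        smooth_on_bounded_linear[OF bounded_linear_inner_left] X)
qed

lemma curvature_metric_riemannian:
  fixes R :: "(real^'m) tensor4"
  assumes R: "R \<in> positive_curvature_tensors"
  shows "curvature_metric R \<in> riemannian_metrics"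
proof -
  note a = positive_curvatureD(1)[OF R]
  note lin = curvature_tensorD(1-4)[OF a]
  let ?e = "2 / (2 - real CARD('m))"
  have det: "smooth_on (jacobi_det R) unit_sphere"
  proof -
    have "smooth_on (\<lambda>x. \<Sum>p\<in>{p. p permutes (UNIV :: 'm set)}. of_int (sign p) *
        (\<Prod>i\<in>UNIV. R x (axis i 1) x (axis (p i) 1) + (x \<bullet> axis i 1) * (x \<bullet> axis (p i) 1))) unit_sphere"
      by (intro smooth_on_sum smooth_on_bilinear[OF bounded_bilinear_mult] smooth_on_const smooth_on_prod
          smooth_on_add smooth_on_multilinear[OF a] smooth_on_bounded_linear[OF bounded_linear_inner_left] smooth_on_id)
    then show ?thesis
      by (simp add: jacobi_det_def[abs_def] tangent_det_def det_def form_matrix_def filled_form_def)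
  qed
  have smooth: "smooth_on (\<lambda>x. curvature_metric R x (X x) (Y x)) unit_sphere"
    if X: "smooth_vector_field X" and Y: "smooth_vector_field Y" for X Y
  proof -
    have "smooth_on (\<lambda>x. jacobi_det R x powr ?e * R x (X x) x (Y x)) unit_sphere"
      using X Y jacobi_det_pos[OF R] unfolding smooth_vector_field_def
      by (intro smooth_on_bilinear[OF bounded_bilinear_mult] smooth_on_powr det smooth_on_multilinear[OF a] smooth_on_id) auto
    then show ?thesis
      by (rule smooth_on_cong) (use X Y in \<open>simp add: curvature_metric_def smooth_vector_field_def\<close>)
  qed
  have sub: "u + v \<in> sphere_tangent x" "c *\<^sub>R u \<in> sphere_tangent x"
    if "u \<in> sphere_tangent x" "v \<in> sphere_tangent x" for u v x :: "real^'m" and c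
    using that subspace_sphere_tangent[of x] by (auto simp: subspace_add subspace_scale)
  show ?thesis
    unfolding riemannian_metrics_def
  proof (intro CollectI conjI ballI allI impI)
    fix x u v w :: "real^'m" and c :: real
    assume x: "x \<in> unit_sphere" and t: "u \<in> sphere_tangent x" "v \<in> sphere_tangent x" "w \<in> sphere_tangent x"
    show "curvature_metric R x (u + v) w = curvature_metric R x u w + curvature_metric R x v w"
      "curvature_metric R x (c *\<^sub>R u) w = c * curvature_metric R x u w"
      "curvature_metric R x u v = curvature_metric R x v u"
      using x t sub curvature_tensorD(7)[OF a, of x u x v]
      by (simp_all add: curvature_metric_def linear_add[OF lin(2)] linear_scale[OF lin(2)] algebra_simps)
  next
    fix x u :: "real^'m" assume x: "x \<in> unit_sphere" and u: "u \<in> sphere_tangent x" "u \<noteq> 0"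
    then show "curvature_metric R x u u > 0"
      using jacobi_form_pos[OF R _ u] jacobi_det_pos[OF R, of x] by (simp add: curvature_metric_def)
  next
    fix X Y :: "real^'m \<Rightarrow> real^'m" assume "smooth_vector_field X" "smooth_vector_field Y"
    then show "smooth_on (\<lambda>x. curvature_metric R x (X x) (Y x)) unit_sphere" by (rule smooth)
  next
    fix x u v :: "real^'m"
    assume "\<not> (x \<in> unit_sphere \<and> u \<in> sphere_tangent x \<and> v \<in> sphere_tangent x)"
    then show "curvature_metric R x u v = 0" by (auto simp: curvature_metric_def)
  qed
qed

lemma curvature_metric_ext:
  fixes R :: "(real^'m) tensor4"
  assumes a: "algebraic_curvature_tensor R" and x: "norm x = 1"
  shows "metric_ext (curvature_metric R) x u v = jacobi_det R x powr (2 / (2 - real CARD('m))) * R x u x v"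
proof -
  note lin = curvature_tensorD(2,4)[OF a]
  have "R x (tangent_extension u x) x (tangent_extension v x) = R x u x v"
    unfolding tangent_extension_def
    by (simp add: linear_diff[OF lin(1)] linear_diff[OF lin(2)] linear_scale[OF lin(1)] linear_scale[OF lin(2)]
        curvature_tensor_same[OF a])
  then show ?thesis
    using x tangent_extension_tangent[OF x] by (simp add: metric_ext_def curvature_metric_def)
qed

lemma killing_form_curvature_metric:
  fixes R :: "(real^'m) tensor4"
  assumes R: "R \<in> positive_curvature_tensors" and x: "norm x = 1" and m: "CARD('m) \<ge> 3"
  shows "killing_form (curvature_metric R) x u v = R x u x v"
proof -
  note a = positive_curvatureD(1)[OF R]
  define D where "D = jacobi_det R x"
  define \<rho> where "\<rho> = D powr (2 / (2 - real CARD('m)))"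
  have D: "D > 0" using jacobi_det_pos[OF R x] by (simp add: D_def)
  then have \<rho>: "\<rho> > 0" by (simp add: \<rho>_def)
  have "metric_det (curvature_metric R) x = tangent_det (\<lambda>u v. \<rho> * R x u x v) x"
    by (simp add: metric_det_def curvature_metric_ext[OF a x, abs_def] \<rho>_def D_def)
  also have "\<dots> = \<rho> ^ (CARD('m) - 1) * D"
    unfolding D_def jacobi_det_def
    by (rule tangent_det_scale[OF jacobi_form_bilinear[OF a] x \<rho>]) (simp_all add: curvature_tensor_same[OF a])
  finally have det: "metric_det (curvature_metric R) x = \<rho> ^ (CARD('m) - 1) * D" .
  have "metric_det (curvature_metric R) x powr (- 2 / real CARD('m)) * \<rho> = 1"
  proof -
    let ?m = "real CARD('m)"
    have m': "?m \<ge> 3" using m by simp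
    have ln\<rho>: "ln \<rho> = 2 / (2 - ?m) * ln D" using D by (simp add: \<rho>_def ln_powr)
    have "ln (\<rho> ^ (CARD('m) - 1) * D) = (?m - 1) * ln \<rho> + ln D"
      using D \<rho> m by (simp add: ln_mult ln_realpow of_nat_diff)
    then have "ln (metric_det (curvature_metric R) x powr (- 2 / ?m) * \<rho>) = - 2 / ?m * ((?m - 1) * ln \<rho> + ln D) + ln \<rho>"
      unfolding det using D \<rho> by (simp add: ln_mult ln_powr)
    also have "\<dots> = 0" unfolding ln\<rho> using m' by (simp add: field_simps)
    finally show ?thesis using D \<rho> by (simp add: det)
  qed
  then show ?thesis
    by (simp add: killing_form_def curvature_metric_ext[OF a x] \<rho>_def D_def)
qed

text \<open>The Killing equation for \<open>R x u x v\<close> reads \<open>R N N x N + R x N N N = 0\<close>, which is the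
  antisymmetry of \<open>R\<close>.\<close>

lemma curvature_metric_equator_minimal:
  fixes R :: "(real^'m) tensor4"
  assumes R: "R \<in> positive_curvature_tensors" and m: "CARD('m) \<ge> 3"
  shows "curvature_metric R \<in> equator_minimal_metrics"
  unfolding equator_minimal_iff_killing[OF curvature_metric_riemannian[OF R]]
proof (intro allI impI)
  fix x N :: "real^'m" assume x: "norm x = 1" and N: "N \<in> sphere_tangent x"
  note a = positive_curvatureD(1)[OF R]
  note lin = curvature_tensorD(1-4)[OF a]
  have b: "bilinear (\<lambda>u v. R u N v N)" using lin(1,3) by (simp add: bilinear_def)
  have "((\<lambda>y. R (y /\<^sub>R norm y) N (y /\<^sub>R norm y) N) has_derivative
      (\<lambda>s. 0 + R (s - (s \<bullet> x) *\<^sub>R x) N (x /\<^sub>R norm x) N + R (x /\<^sub>R norm x) N (s - (s \<bullet> x) *\<^sub>R x) N)) (at x)"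
    by (rule has_derivative_bilinear_family[OF b has_derivative_const has_derivative_radial[OF x] has_derivative_radial[OF x]])
  moreover have "(\<lambda>y. R (y /\<^sub>R norm y) N (y /\<^sub>R norm y) N) = (\<lambda>y. killing_form (curvature_metric R) (y /\<^sub>R norm y) N N)"
  proof
    fix y :: "real^'m"
    show "R (y /\<^sub>R norm y) N (y /\<^sub>R norm y) N = killing_form (curvature_metric R) (y /\<^sub>R norm y) N N"
    proof (cases "y = 0")
      case True
      then show ?thesis
        using bilinear_lzero[OF b] by (simp add: killing_form_def metric_ext_def curvature_metric_def)
    next
      case False
      then show ?thesis by (simp add: killing_form_curvature_metric[OF R _ m])
    qed
  qed
  ultimately have "((\<lambda>y. killing_form (curvature_metric R) (y /\<^sub>R norm y) N N) has_derivative
      (\<lambda>s. R (s - (s \<bullet> x) *\<^sub>R x) N x N + R x N (s - (s \<bullet> x) *\<^sub>R x) N)) (at x)"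
    using x by simp
  from sphere_deriv_eqI[of "\<lambda>y. killing_form (curvature_metric R) y N N", OF this] show "sphere_deriv (\<lambda>y. killing_form (curvature_metric R) y N N) x N = 0"
    using N by (simp add: sphere_tangent_def curvature_tensor_same[OF a])
qed

lemma equator_minimal_is_curvature_metric:
  fixes g :: "(real^'m) metric"
  assumes g: "g \<in> equator_minimal_metrics" and m: "CARD('m) \<ge> 3"
  shows "\<exists>R \<in> positive_curvature_tensors. g = curvature_metric R"
proof -
  have gr: "g \<in> riemannian_metrics" using g by (simp add: equator_minimal_metrics_def)
  obtain R where R: "R \<in> positive_curvature_tensors"
    and eq: "\<And>x u v. norm x = 1 \<Longrightarrow> killing_form g x u v = R x u x v"
    using killing_form_curvature[OF g] by blast
  have "g x u v = curvature_metric R x u v" for x u v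
  proof (cases "norm x = 1 \<and> u \<in> sphere_tangent x \<and> v \<in> sphere_tangent x")
    case False
    then have "g x u v = 0" using riemannian_zero[OF gr] riemannian_zero_not_tangent[OF gr] by blast
    then show ?thesis using False by (auto simp: curvature_metric_def)
  next
    case True
    then have x: "norm x = 1" by simp
    obtain E where "tangent_basis g x E" using tangent_basis_exists[OF gr x] by blast
    then have d: "metric_det g x > 0" using metric_det_has_derivative(1)[OF gr x] by blast
    define d where "d = metric_det g x"
    let ?m = "real CARD('m)"
    define c where "c = d powr (- 2 / ?m)"
    have d: "d > 0" using d by (simp add: d_def)
    then have c: "c > 0" by (simp add: c_def)
    have m': "?m \<ge> 3" using m by simp
    have "jacobi_det R x = tangent_det (killing_form g x) x"
      unfolding jacobi_det_def eq[OF x, symmetric] ..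
    also have "killing_form g x = (\<lambda>u v. c * metric_ext g x u v)"
      by (simp add: killing_form_def c_def d_def fun_eq_iff)
    also have "tangent_det \<dots> x = c ^ (CARD('m) - 1) * d"
      unfolding d_def metric_det_def
      by (rule tangent_det_scale[OF metric_ext_bilinear[OF gr] x c]) (simp_all add: metric_ext_self[OF gr x])
    finally have det: "jacobi_det R x = c ^ (CARD('m) - 1) * d" .
    have "jacobi_det R x powr (2 / (2 - ?m)) * c = 1"
    proof -
      have lnc: "ln c = - 2 / ?m * ln d" using d by (simp add: c_def ln_powr)
      have "ln (c ^ (CARD('m) - 1) * d) = (?m - 1) * ln c + ln d"
        using d c m by (simp add: ln_mult ln_realpow of_nat_diff)
      then have "ln (jacobi_det R x powr (2 / (2 - ?m)) * c) = 2 / (2 - ?m) * ((?m - 1) * ln c + ln d) + ln c"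
        unfolding det using d c by (simp add: ln_mult ln_powr)
      also have "\<dots> = 0" unfolding lnc using m' by (simp add: field_simps)
      finally show ?thesis using d c by (simp add: det)
    qed
    moreover have "R x u x v = c * g x u v"
      using True by (simp add: eq[OF x, symmetric] killing_form_def c_def d_def metric_ext_eq)
    ultimately show ?thesis using True by (simp add: curvature_metric_def flip: mult.assoc)
  qed
  then have "g = curvature_metric R" by (intro ext)
  then show ?thesis using R by blast
qed

text \<open>The curvature tensor is recovered from the metric through its Killing form.\<close>

lemma curvature_metric_inj:
  assumes m: "CARD('m::finite) \<ge> 3"
  shows "inj_on curvature_metric (positive_curvature_tensors :: (real^'m) tensor4 set)"
proof (rule inj_onI)
  fix R R' :: "(real^'m) tensor4"
  assume R: "R \<in> positive_curvature_tensors" and R': "R' \<in> positive_curvature_tensors"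
    and eq: "curvature_metric R = curvature_metric R'"
  note a = positive_curvatureD(1)[OF R] positive_curvatureD(1)[OF R']
  have unit: "R x u x v = R' x u x v" if "norm x = 1" for x u v
    using killing_form_curvature_metric[OF R that m] killing_form_curvature_metric[OF R' that m] eq by metis
  have "R x u x v = R' x u x v" for x u v
  proof (cases "x = 0")
    case True
    then show ?thesis using linear_0[OF curvature_tensorD(1)[OF a(1)]] linear_0[OF curvature_tensorD(1)[OF a(2)]] by simp
  next
    case False
    have s: "T (c *\<^sub>R x) u (c *\<^sub>R x) v = c * (c * T x u x v)" if "algebraic_curvature_tensor T" for T and c :: real
      using linear_scale[OF curvature_tensorD(1)[OF that]] linear_scale[OF curvature_tensorD(3)[OF that]] by simp
    show ?thesis using unit[of "x /\<^sub>R norm x" u v] False by (simp add: s[OF a(1)] s[OF a(2)])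
  qed
  then show "R = R'" by (rule curvature_tensor_eqI[OF a])
qed

section \<open>Equivariance\<close>

lemma invertible_mult_nonzero:
  fixes T :: "real^'m^'m"
  assumes "invertible T" "x \<noteq> 0"
  shows "T *v x \<noteq> 0"
proof
  assume z: "T *v x = 0"
  obtain T' where "T' ** T = mat 1" using assms(1) unfolding invertible_def by blast
  then have "T' *v (T *v x) = x" by (simp add: matrix_vector_mul_assoc)
  then show False using z assms(2) by simp
qed

lemma transform_tensor_positive:
  fixes T :: "real^'m^'m"
  assumes T: "invertible T" and R: "R \<in> positive_curvature_tensors"
  shows "transform_tensor T R \<in> positive_curvature_tensors"
proof -
  note a = positive_curvatureD(1)[OF R]
  note c = curvature_tensorD[OF a]
  let ?k = "1 / (\<bar>det T\<bar> powr (4 / real CARD('m)))"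
  have "det T \<noteq> 0" using T by (simp add: invertible_det_nz)
  then have k: "?k > 0" by simp
  have lin: "linear (\<lambda>t. ?k * f (T *v t))" if "linear f" for f :: "real^'m \<Rightarrow> real"
    using that by (simp add: linear_iff matrix_vector_right_distrib matrix_vector_mult_scaleR algebra_simps add_divide_distrib)
  have "algebraic_curvature_tensor (transform_tensor T R)"
    unfolding algebraic_curvature_tensor_def
  proof (intro conjI allI)
    fix x y z w
    show "linear (\<lambda>x. transform_tensor T R x y z w)" "linear (\<lambda>y. transform_tensor T R x y z w)"
      "linear (\<lambda>z. transform_tensor T R x y z w)" "linear (\<lambda>w. transform_tensor T R x y z w)"
      unfolding transform_tensor_def by (intro lin c)+
    show "transform_tensor T R x y z w = - transform_tensor T R y x z w"
      using c(5)[of "T *v x" "T *v y" "T *v z" "T *v w"] by (simp add: transform_tensor_def)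
    show "transform_tensor T R x y z w = - transform_tensor T R x y w z"
      using c(6)[of "T *v x" "T *v y" "T *v z" "T *v w"] by (simp add: transform_tensor_def)
    show "transform_tensor T R x y z w = transform_tensor T R z w x y"
      using c(7)[of "T *v x" "T *v y" "T *v z" "T *v w"] by (simp add: transform_tensor_def)
    show "transform_tensor T R x y z w + transform_tensor T R x z w y + transform_tensor T R x w y z = 0"
      unfolding transform_tensor_def distrib_left[symmetric] c(8) by simp
  qed
  moreover have "transform_tensor T R v w v w > 0" if vw: "norm v = 1" "norm w = 1" "v \<bullet> w = 0" for v w
  proof -
    have v0: "v \<noteq> 0" using vw by auto
    \<comment> \<open>The coefficient of the projection to \<open>T v\<close>, written as a multiple of \<open>T v\<close> so that it can be moved inside \<open>T\<close>.\<close>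
    let ?p = "(T *v w) \<bullet> ((T *v v) /\<^sub>R norm (T *v v)) / norm (T *v v)"
    have "(T *v w) - ((T *v w) \<bullet> ((T *v v) /\<^sub>R norm (T *v v))) *\<^sub>R ((T *v v) /\<^sub>R norm (T *v v)) = T *v (w - ?p *\<^sub>R v)"
      by (simp add: matrix_vector_mult_diff_distrib matrix_vector_mult_scaleR divide_inverse)
    moreover have "w - ?p *\<^sub>R v \<noteq> 0"
    proof
      assume "w - ?p *\<^sub>R v = 0"
      then have "w \<bullet> w = ?p * (v \<bullet> w)" by (metis eq_iff_diff_eq_0 inner_scaleR_left)
      then show False using vw by (simp add: dot_square_norm)
    qed
    ultimately have "R (T *v v) (T *v w) (T *v v) (T *v w) > 0"
      by (intro positive_curvatureD(2)[OF R] invertible_mult_nonzero[OF T v0])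
        (simp only: invertible_mult_nonzero[OF T] not_False_eq_True)
    then show ?thesis unfolding transform_tensor_def using k by (rule mult_pos_pos[rotated])
  qed
  ultimately show ?thesis by (simp add: positive_curvature_tensors_def)
qed

lemma transform_tensor_scale:
  fixes T :: "real^'m^'m"
  assumes R: "algebraic_curvature_tensor R" and c: "c \<noteq> 0"
  shows "transform_tensor (mat c ** T) R = transform_tensor T R"
proof (intro ext)
  fix x y z w :: "real^'m"
  note lin = curvature_tensorD(1-4)[OF R]
  have v: "(mat c ** T) *v u = c *\<^sub>R (T *v u)" for u
    unfolding matrix_vector_mul_assoc[symmetric] by (rule scalar_matrix_vector_mult)
  have "\<bar>det (mat c ** T)\<bar> powr (4 / real CARD('m)) = (\<bar>c\<bar> ^ CARD('m)) powr (4 / real CARD('m)) * \<bar>det T\<bar> powr (4 / real CARD('m))"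
    by (simp add: det_mul det_scalar_matrix abs_mult power_abs powr_mult)
  also have "(\<bar>c\<bar> ^ CARD('m)) powr (4 / real CARD('m)) = c ^ 4"
  proof -
    have "(\<bar>c\<bar> ^ CARD('m)) powr (4 / real CARD('m)) = (\<bar>c\<bar> powr real CARD('m)) powr (4 / real CARD('m))"
      using c by (simp add: powr_realpow)
    also have "\<dots> = \<bar>c\<bar> powr (real 4)" unfolding powr_powr by simp
    also have "\<dots> = \<bar>c\<bar> ^ 4" using c by (intro powr_realpow) simp
    finally show ?thesis by (simp add: power_even_abs)
  qed
  finally have d: "\<bar>det (mat c ** T)\<bar> powr (4 / real CARD('m)) = c ^ 4 * \<bar>det T\<bar> powr (4 / real CARD('m))" .
  show "transform_tensor (mat c ** T) R x y z w = transform_tensor T R x y z w"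
    unfolding transform_tensor_def d v
    using c by (simp add: linear_scale[OF lin(1)] linear_scale[OF lin(2)] linear_scale[OF lin(3)] linear_scale[OF lin(4)]
        power4_eq_xxxx)
qed

text \<open>The radial extension of \<open>sphere_map T\<close> is \<open>T\<close> followed by radial projection, and rescaling \<open>T\<close> moves
  \<open>T x\<close> to the sphere, where the derivative of the projection is known.\<close>

lemma sphere_deriv_sphere_map:
  fixes T :: "real^'m^'m"
  assumes T: "invertible T" and x: "norm x = 1"
  shows "sphere_deriv (sphere_map T) x u = tangent_extension ((T *v u) /\<^sub>R norm (T *v x)) (sphere_map T x)"
proof -
  define r where "r = norm (T *v x)"
  have "x \<noteq> 0" using x by auto
  then have r: "r > 0" using invertible_mult_nonzero[OF T] by (simp add: r_def)
  define S where "S y = (T *v y) /\<^sub>R r" for y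
  have S: "(S has_derivative S) (at x)"
    unfolding S_def[abs_def]
    by (intro has_derivative_scaleR_right bounded_linear_imp_has_derivative matrix_vector_mul_bounded_linear)
  have nS: "norm (S x) = 1" using r by (simp add: S_def r_def)
  have "((\<lambda>y. S y /\<^sub>R norm (S y)) has_derivative (\<lambda>u. S u - (S u \<bullet> S x) *\<^sub>R S x)) (at x)"
    using diff_chain_at[OF S has_derivative_radial[OF nS]] by (simp add: o_def)
  moreover have "(\<lambda>y. S y /\<^sub>R norm (S y)) = (\<lambda>y. sphere_map T (y /\<^sub>R norm y))"
  proof
    fix y
    show "S y /\<^sub>R norm (S y) = sphere_map T (y /\<^sub>R norm y)"
      using r by (cases "y = 0") (simp_all add: S_def sphere_map_def matrix_vector_mult_scaleR)
  qed
  ultimately have "((\<lambda>y. sphere_map T (y /\<^sub>R norm y)) has_derivative (\<lambda>u. S u - (S u \<bullet> S x) *\<^sub>R S x)) (at x)"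
    by simp
  from sphere_deriv_eqI[of "sphere_map T", OF this] show ?thesis
    by (simp add: tangent_extension_def S_def sphere_map_def r_def)
qed

text \<open>Pulling back gives the Jacobi form of the transformed tensor at \<open>x\<close> up to a positive factor
  depending on \<open>x\<close>. The powers of \<open>norm (T x)\<close> and of \<open>\<bar>det T\<bar>\<close> that arise agree by \<open>tangent_det_pullback\<close>; this is
  where the normalisation of the action on tensors comes from.\<close>

lemma curvature_metric_equivariant:
  fixes T :: "real^'m^'m"
  assumes T: "invertible T" and R: "R \<in> positive_curvature_tensors" and m: "CARD('m) \<ge> 3"
  shows "pullback_metric (sphere_map T) (curvature_metric R) = curvature_metric (transform_tensor T R)"
proof (intro ext)
  fix x u v :: "real^'m"
  note a = positive_curvatureD(1)[OF R]
  note lin = curvature_tensorD(1-4)[OF a]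
  show "pullback_metric (sphere_map T) (curvature_metric R) x u v = curvature_metric (transform_tensor T R) x u v"
  proof (cases "norm x = 1 \<and> u \<in> sphere_tangent x \<and> v \<in> sphere_tangent x")
    case False
    then show ?thesis by (auto simp: pullback_metric_def curvature_metric_def)
  next
    case True
    then have x: "norm x = 1" by simp
    define y where "y = T *v x"
    define r where "r = norm y"
    define \<eta> where "\<eta> = y /\<^sub>R r"
    define \<delta> where "\<delta> = \<bar>det T\<bar>"
    define D where "D = jacobi_det R \<eta>"
    let ?m = "real CARD('m)" and ?e = "2 / (2 - real CARD('m))"
    have m': "?m \<ge> 3" using m by simp
    have "x \<noteq> 0" using x by auto
    then have y0: "y \<noteq> 0" unfolding y_def by (rule invertible_mult_nonzero[OF T])
    then have r: "r > 0" by (simp add: r_def)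
    have n\<eta>: "norm \<eta> = 1" using y0 by (simp add: \<eta>_def r_def)
    have D: "D > 0" unfolding D_def by (rule jacobi_det_pos[OF R n\<eta>])
    have \<delta>: "\<delta> > 0" using T by (simp add: \<delta>_def invertible_det_nz)
    define c where "c = r\<^sup>2 / \<delta> powr (4 / ?m)"
    have c: "c > 0" using r \<delta> by (simp add: c_def)
    have sm: "sphere_map T x = \<eta>" by (simp add: sphere_map_def \<eta>_def y_def r_def)
    define h where "h = (\<lambda>u v. c * R \<eta> u \<eta> v)"
    have ry: "y = r *\<^sub>R \<eta>" using r by (simp add: \<eta>_def)
    have tr: "transform_tensor T R x u x v = h (T *v u) (T *v v)" for u v
      unfolding transform_tensor_def y_def[symmetric] h_def unfolding ry
      by (simp add: linear_scale[OF lin(1)] linear_scale[OF lin(3)] c_def \<delta>_def power2_eq_square)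
    have bh: "bilinear h"
      using jacobi_form_bilinear[OF a, of \<eta>] unfolding h_def bilinear_def by (auto simp: linear_iff algebra_simps)
    have hy: "h y u = 0" "h u y = 0" for u
      unfolding h_def ry by (simp_all add: linear_scale[OF lin(2)] linear_scale[OF lin(4)] curvature_tensor_same[OF a])
    have "jacobi_det (transform_tensor T R) x = tangent_det (\<lambda>u v. h (T *v u) (T *v v)) x"
      by (simp add: jacobi_det_def tr)
    also have "\<dots> = (det T / r)\<^sup>2 * tangent_det h \<eta>"
      unfolding \<eta>_def r_def by (rule tangent_det_pullback[OF bh T x y_def hy])
    also have "tangent_det h \<eta> = c ^ (CARD('m) - 1) * D"
      unfolding D_def jacobi_det_def h_def
      by (rule tangent_det_scale[OF jacobi_form_bilinear[OF a] n\<eta> c]) (simp_all add: curvature_tensor_same[OF a])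
    finally have det: "jacobi_det (transform_tensor T R) x = (\<delta> / r)\<^sup>2 * (c ^ (CARD('m) - 1) * D)"
      by (simp add: \<delta>_def power_divide)
    have key: "jacobi_det (transform_tensor T R) x powr ?e * c = D powr ?e / r\<^sup>2"
    proof -
      have lnc: "ln c = 2 * ln r - 4 / ?m * ln \<delta>"
        using r \<delta> by (simp add: c_def ln_div ln_powr ln_realpow)
      have lnj: "ln ((\<delta> / r)\<^sup>2 * (c ^ (CARD('m) - 1) * D)) = 2 * (ln \<delta> - ln r) + ((?m - 1) * ln c + ln D)"
        using r \<delta> c D m by (simp add: ln_mult ln_div ln_realpow of_nat_diff)
      have pos: "(\<delta> / r)\<^sup>2 * (c ^ (CARD('m) - 1) * D) > 0" using r \<delta> c D by simp
      have "ln (jacobi_det (transform_tensor T R) x powr ?e * c) = ?e * (2 * (ln \<delta> - ln r) + ((?m - 1) * ln c + ln D)) + ln c"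
        unfolding det lnj[symmetric] using pos c r \<delta> D by (simp add: ln_mult ln_powr)
      also have "\<dots> = ?e * ln D - 2 * ln r"
        unfolding lnc using m' by (simp add: field_simps)
      also have "\<dots> = ln (D powr ?e / r\<^sup>2)" using D r by (simp add: ln_div ln_powr ln_realpow)
      finally have "ln (jacobi_det (transform_tensor T R) x powr ?e * c) = ln (D powr ?e / r\<^sup>2)" .
      moreover have "jacobi_det (transform_tensor T R) x powr ?e * c > 0" "D powr ?e / r\<^sup>2 > 0"
        using pos[folded det] c D r by auto
      ultimately show ?thesis using ln_inj_iff by blast
    qed
    have "pullback_metric (sphere_map T) (curvature_metric R) x u v
        = metric_ext (curvature_metric R) \<eta> ((T *v u) /\<^sub>R r) ((T *v v) /\<^sub>R r)"
      using True unfolding pullback_metric_def metric_ext_def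
      by (simp add: sphere_deriv_sphere_map[OF T x] sm) (simp add: r_def y_def)
    also have "\<dots> = D powr ?e / r\<^sup>2 * R \<eta> (T *v u) \<eta> (T *v v)"
      unfolding curvature_metric_ext[OF a n\<eta>] D_def[symmetric]
      by (simp add: linear_scale[OF lin(2)] linear_scale[OF lin(4)] divide_inverse power2_eq_square)
    also have "\<dots> = jacobi_det (transform_tensor T R) x powr ?e * h (T *v u) (T *v v)"
      unfolding key[symmetric] by (simp add: h_def)
    also have "\<dots> = curvature_metric (transform_tensor T R) x u v"
      using True by (simp add: curvature_metric_def tr)
    finally show ?thesis .
  qed
qed

lemma PGL_carrierE:
  assumes "C \<in> carrier (PGL :: (real^'m^'m) set monoid)"
  obtains T :: "real^'m^'m" where "invertible T" "C = {mat c ** T | c. c \<noteq> 0}"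
proof -
  from assms obtain T :: "real^'m^'m" where T: "invertible T" "C = {mat c | c. c \<noteq> 0} #>\<^bsub>GL\<^esub> T"
    by (auto simp: PGL_def FactGroup_def RCOSETS_def GL_def)
  then have "C = {mat c ** T | c. c \<noteq> 0}" by (auto simp: r_coset_def GL_def)
  with T(1) show thesis by (rule that)
qed

theorem mainTheorem1:
  fixes n :: nat
  assumes "n \<ge> 2" and "CARD('m::finite) = n + 1"
  shows "\<exists>F :: (real^'m) metric \<Rightarrow> (real^'m) tensor4.
    bij_betw F equator_minimal_metrics positive_curvature_tensors \<and>
    (\<forall>C\<in>carrier PGL. \<forall>g\<in>equator_minimal_metrics.
       metric_action g C \<in> equator_minimal_metrics \<and>
       F (metric_action g C) = tensor_action (F g) C)"
proof -
  have m: "CARD('m) \<ge> 3" using assms by simp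
  let ?P = "positive_curvature_tensors :: (real^'m) tensor4 set"
  have inj: "inj_on curvature_metric ?P" by (rule curvature_metric_inj[OF m])
  have bij: "bij_betw curvature_metric ?P equator_minimal_metrics"
    unfolding bij_betw_def
    using inj curvature_metric_equator_minimal[OF _ m] equator_minimal_is_curvature_metric[OF _ m] by blast
  define F where "F = inv_into ?P curvature_metric"
  have FR: "F (curvature_metric R) = R" if "R \<in> ?P" for R
    unfolding F_def by (rule inv_into_f_f[OF inj that])
  have "metric_action g C \<in> equator_minimal_metrics \<and> F (metric_action g C) = tensor_action (F g) C"
    if C: "C \<in> carrier PGL" and g: "g \<in> equator_minimal_metrics" for C and g :: "(real^'m) metric"
  proof -
    obtain R where R: "R \<in> ?P" and gR: "g = curvature_metric R"
      using equator_minimal_is_curvature_metric[OF g m] by blast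
    obtain T :: "real^'m^'m" where T: "invertible T" and CT: "C = {mat c ** T | c. c \<noteq> 0}"
      by (rule PGL_carrierE[OF C])
    let ?R = "transform_tensor T R"
    have R': "?R \<in> ?P" by (rule transform_tensor_positive[OF T R])
    \<comment> \<open>The two actions evaluate \<open>the_elem\<close> of an image of the class, so this image has to be a nonempty constant.\<close>
    have one: "mat 1 ** T \<in> C" unfolding CT by (intro CollectI exI[of _ 1]) simp
    have t: "transform_tensor S R = ?R" if "S \<in> C" for S
      using that transform_tensor_scale[OF positive_curvatureD(1)[OF R]] unfolding CT by auto
    have inv: "invertible S" if S: "S \<in> C" for S
    proof -
      obtain c where c: "c \<noteq> 0" "S = mat c ** T" using S unfolding CT by auto
      then show ?thesis using T by (simp add: invertible_det_nz det_mul det_scalar_matrix)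
    qed
    have "(\<lambda>S. transform_tensor S R) ` C = {?R}"
      by (rule trans[OF image_cong[OF refl t] image_constant[OF one]])
    then have ta: "tensor_action R C = ?R" by (simp add: tensor_action_def)
    have p: "pullback_metric (sphere_map S) g = curvature_metric ?R" if "S \<in> C" for S
      using curvature_metric_equivariant[OF inv[OF that] R m] t[OF that] gR by simp
    have "(\<lambda>S. pullback_metric (sphere_map S) g) ` C = {curvature_metric ?R}"
      by (rule trans[OF image_cong[OF refl p] image_constant[OF one]])
    then have ma: "metric_action g C = curvature_metric ?R" by (simp add: metric_action_def)
    show ?thesis
      unfolding ma unfolding gR FR[OF R'] FR[OF R] ta using curvature_metric_equator_minimal[OF R' m] by simp
  qed
  moreover have "bij_betw F equator_minimal_metrics ?P"
    unfolding F_def by (rule bij_betw_inv_into[OF bij])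
  ultimately show ?thesis by blast
qed

end
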